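(* Let $N=\binom{n}{3n/4}$. There is a constant $\varepsilon_0>0$ such that any two-sided, non-adaptive algorithm (with access to $\mathrm{MQ}(f)$ and $\mathrm{Samp}(f)$) for testing whether a function $f:\{0,1\}^n\to\{0,1\}$ with $|f^{-1}(1)|=\Theta(N)$ is monotone or has relative distance at least $\varepsilon_0$ from monotone functions must make $\tilde{\Omega}(\log N)$ queries.
   Context: $n$ is divisible by $4$. $\mathrm{rel\text{-}dist}(f,g)=|f^{-1}(1)\triangle g^{-1}(1)|/|f^{-1}(1)|$; distance to the class of monotone functions is the minimum over that class. $\mathrm{MQ}(f)$ returns $f(x)$ on query $x$; $\mathrm{Samp}(f)$ returns an independent uniform element of $f^{-1}(1)$. A tester accepts monotone $f$ with probability at least $2/3$ and rejects $f$ at relative distance at least $\varepsilon_0$ with probability at least $2/3$ (two-sided error allowed). Non-adaptive: after all $\mathrm{Samp}(f)$ calls, the $\mathrm{MQ}(f)$ queries are made in one parallel round. Queries count calls to both oracles. *)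

theory Defs
  imports "HOL-Probability.Probability"
begin

text \<open>
  \<open>{0,1}\<^sup>n\<close> as extensional functions on \<open>{..<n}\<close>. All its elements agree outside \<open>{..<n}\<close>, so the
  library order on functions restricts to the coordinatewise order. A function
  \<open>f : {0,1}\<^sup>n \<rightarrow> {0,1}\<close> is an \<open>f :: point \<Rightarrow> bool\<close> of which only the values on \<open>cube n\<close> matter,
  and it is monotone iff \<open>mono_on (cube n) f\<close>.
\<close>

type_synonym point = "nat \<Rightarrow> bool"

definition cube :: "nat \<Rightarrow> point set" where
  "cube n = {..<n} \<rightarrow>\<^sub>E UNIV"

definition ones :: "nat \<Rightarrow> (point \<Rightarrow> bool) \<Rightarrow> point set" where
  "ones n f = {x \<in> cube n. f x}"

definition rel_dist :: "nat \<Rightarrow> (point \<Rightarrow> bool) \<Rightarrow> (point \<Rightarrow> bool) \<Rightarrow> real" where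
  "rel_dist n f g = real (card (sym_diff (ones n f) (ones n g))) / real (card (ones n f))"

definition rel_dist_mono :: "nat \<Rightarrow> (point \<Rightarrow> bool) \<Rightarrow> real" where
  "rel_dist_mono n f = Min (rel_dist n f ` {g. mono_on (cube n) g})"

text \<open>The minimum above is taken over a finite nonempty set.\<close>

lemma finite_cube: "finite (cube n)"
  unfolding cube_def by (intro finite_PiE) auto

lemma finite_rel_dist_values: "finite (rel_dist n f ` {g. mono_on (cube n) g})"
proof (rule finite_subset)
  let ?d = "\<lambda>S. real (card (sym_diff (ones n f) S)) / real (card (ones n f))"
  show "rel_dist n f ` {g. mono_on (cube n) g} \<subseteq> ?d ` Pow (cube n)"
    by (auto simp: rel_dist_def ones_def intro!: image_eqI)
  show "finite (?d ` Pow (cube n))"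
    by (simp add: finite_cube)
qed

lemma rel_dist_values_nonempty: "rel_dist n f ` {g. mono_on (cube n) g} \<noteq> {}"
proof -
  have "mono_on (cube n) (\<lambda>_. False)" by (simp add: mono_on_def)
  then show ?thesis by blast
qed

text \<open>
  A deterministic non-adaptive strategy first makes calls to \<open>Samp(f)\<close>, one per \<open>Draw\<close>; whether to
  draw again may depend on the samples seen so far. Then \<open>Ask xs d\<close> sends the whole list \<open>xs\<close> to
  \<open>MQ(f)\<close> in a single round and outputs the verdict \<open>d\<close> of the answers (\<open>True\<close> means accept).
  Both \<open>xs\<close> and \<open>d\<close> may depend on the samples, since they sit below the \<open>Draw\<close> nodes.
\<close>

datatype strategy =
    Draw "point \<Rightarrow> strategy"
  | Ask "point list" "bool list \<Rightarrow> bool"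

primrec run :: "nat \<Rightarrow> (point \<Rightarrow> bool) \<Rightarrow> strategy \<Rightarrow> bool pmf" where
  "run n f (Draw s) = bind_pmf (pmf_of_set (ones n f)) (\<lambda>x. run n f (s x))"
| "run n f (Ask xs d) = return_pmf (d (map f xs))"

text \<open>On every sequence of samples from the cube, the strategy makes at most \<open>q\<close> calls to the two
  oracles together, and queries \<open>MQ(f)\<close> only at points of the cube.\<close>

primrec query_bound :: "nat \<Rightarrow> strategy \<Rightarrow> nat \<Rightarrow> bool" where
  "query_bound n (Draw s) = (\<lambda>q. q > 0 \<and> (\<forall>x \<in> cube n. query_bound n (s x) (q - 1)))"
| "query_bound n (Ask xs d) = (\<lambda>q. set xs \<subseteq> cube n \<and> length xs \<le> q)"

text \<open>
  A randomized algorithm is a distribution over deterministic strategies, i.e. its internal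
  randomness is drawn in advance. Correctness is required only for functions \<open>f\<close> in the class \<open>F\<close>.
\<close>

definition nonadaptive_tester ::
    "nat \<Rightarrow> (point \<Rightarrow> bool) set \<Rightarrow> real \<Rightarrow> nat \<Rightarrow> strategy pmf \<Rightarrow> bool" where
  "nonadaptive_tester n F \<epsilon> q A \<longleftrightarrow>
     (\<forall>S \<in> set_pmf A. query_bound n S q) \<and>
     (\<forall>f \<in> F. mono_on (cube n) f \<longrightarrow> pmf (bind_pmf A (run n f)) True \<ge> 2 / 3) \<and>
     (\<forall>f \<in> F. rel_dist_mono n f \<ge> \<epsilon> \<longrightarrow> pmf (bind_pmf A (run n f)) False \<ge> 2 / 3)"

end

(*
  Only three layers of the cube matter: f is 0 below weight L = 3n/4 and 1 above weight L + 2. In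
  between sits a Talagrand-type function with about (4/3)^n random terms, each a conjunction of n
  independent random variables: f is 0 where no term holds, 1 where two terms hold, and where the i-th
  term is the only one that holds, f(x) is a random bit b_i in the monotone case and b_i xor x_k xor x_l
  with random k, l (depending on i) otherwise. In the second case a constant fraction of the points of
  weight L starts a chain of length 3 on which f is not monotone, so f is far from monotone.

  Two points of weight about 3n/4 at distance C log n or more satisfy a common term with probability
  at most n^(-C'), so all points seen by the tester under one term lie close to each other. This
  survives the dependence of the queries on the samples: once the samples are far apart from each
  other, the queries depend on a term only through the at most one sample that satisfies it. Hence q
  points expose only O(q log n) coordinates in total, summed over the terms, and unless some k or l is
  exposed, which has probability O(q log n / n), replacing b_i by b_i xor x_k xor x_l turns one case
  into the other. Samples of f are simulated by rejection from the points of weight at least L, of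
  which f^(-1)(1) is a constant fraction.
*)

theory Submission
  imports Defs "HOL-Real_Asymp.Real_Asymp"
begin

section \<open>Averages\<close>

text \<open>All randomness other than that of the tester is uniform on a finite set, so expectations
  are finite sums. On an empty or infinite \<open>A\<close> the value is 0, which lets
  \<open>avg_mono\<close> and \<open>avg_swap\<close> hold for every set.\<close>

definition avg :: "'a set \<Rightarrow> ('a \<Rightarrow> real) \<Rightarrow> real" where
  "avg A f = (\<Sum>a\<in>A. f a) / real (card A)"

lemma avg_cong: "(\<And>a. a \<in> A \<Longrightarrow> f a = g a) \<Longrightarrow> avg A f = avg A g"
  by (simp add: avg_def)

lemma avg_mono: "(\<And>a. a \<in> A \<Longrightarrow> f a \<le> g a) \<Longrightarrow> avg A f \<le> avg A g"
  unfolding avg_def by (intro divide_right_mono sum_mono) auto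

lemma avg_const: "finite A \<Longrightarrow> A \<noteq> {} \<Longrightarrow> avg A (\<lambda>_. c) = c"
  by (simp add: avg_def)

lemma avg_add: "avg A (\<lambda>a. f a + g a) = avg A f + avg A g"
  by (simp add: avg_def sum.distrib add_divide_distrib)

lemma avg_diff: "avg A (\<lambda>a. f a - g a) = avg A f - avg A g"
  by (simp add: avg_def sum_subtractf diff_divide_distrib)

lemma avg_sum: "avg A (\<lambda>a. \<Sum>i\<in>I. f i a) = (\<Sum>i\<in>I. avg A (f i))"
  unfolding avg_def by (subst sum.swap) (simp add: sum_divide_distrib)

lemma avg_mult_right: "avg A (\<lambda>a. f a * c) = avg A f * c"
  by (simp add: avg_def sum_distrib_right)

lemma avg_mult_left: "avg A (\<lambda>a. c * f a) = c * avg A f"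
  by (simp add: avg_def sum_distrib_left)

lemma avg_swap: "avg A (\<lambda>a. avg B (f a)) = avg B (\<lambda>b. avg A (\<lambda>a. f a b))"
  unfolding avg_def sum_divide_distrib[symmetric]
  by (subst sum.swap) (simp add: field_simps)

lemma avg_nonneg: "(\<And>a. a \<in> A \<Longrightarrow> 0 \<le> f a) \<Longrightarrow> 0 \<le> avg A f"
  unfolding avg_def by (intro divide_nonneg_nonneg sum_nonneg) auto

lemma avg_le:
  assumes "\<And>a. a \<in> A \<Longrightarrow> f a \<le> c" and "0 \<le> c"
  shows "avg A f \<le> c"
proof (cases "finite A \<and> A \<noteq> {}")
  case True
  then show ?thesis using avg_mono[of A f "\<lambda>_. c"] assms(1) avg_const[of A c] by auto
next
  case False
  then show ?thesis using assms(2) by (auto simp: avg_def)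
qed

lemma avg_of_bool:
  "finite A \<Longrightarrow> avg A (\<lambda>a. of_bool (P a)) = real (card {a \<in> A. P a}) / real (card A)"
  by (simp add: avg_def of_bool_def sum.If_cases Collect_conj_eq Int_commute)

text \<open>Exchanging \<open>T i\<close> with a fresh \<open>t\<close> is an involution on the
  pairs \<open>(T, t)\<close>. Independence is used in this form later: the other coordinates are
  fixed and only \<open>t\<close> is averaged.\<close>

lemma avg_resample:
  assumes i: "i \<in> I" and fin: "finite A" and ne: "A \<noteq> {}"
  shows "avg (I \<rightarrow>\<^sub>E A) F = avg (I \<rightarrow>\<^sub>E A) (\<lambda>T. avg A (\<lambda>t. F (T(i := t))))"
proof -
  let ?P = "I \<rightarrow>\<^sub>E A"
  have upd: "T(i := t) \<in> ?P" if "T \<in> ?P" "t \<in> A" for T t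
    using that i by (auto simp: PiE_iff extensional_def)
  have "(\<Sum>(T, t)\<in>?P \<times> A. F (T(i := t))) = (\<Sum>(T, t)\<in>?P \<times> A. F T)"
    by (rule sum.reindex_bij_witness[of _ "\<lambda>(T, t). (T(i := t), T i)" "\<lambda>(T, t). (T(i := t), T i)"])
       (use i upd in auto)
  also have "\<dots> = real (card A) * (\<Sum>T\<in>?P. F T)"
    by (simp add: sum.cartesian_product[symmetric] sum_distrib_left)
  finally have "(\<Sum>T\<in>?P. \<Sum>t\<in>A. F (T(i := t))) = real (card A) * (\<Sum>T\<in>?P. F T)"
    by (simp add: sum.cartesian_product)
  then show ?thesis
    using fin ne by (simp add: avg_def sum_divide_distrib[symmetric])
qed

lemma avg_resample_le:
  assumes "i \<in> I" "finite A" "A \<noteq> {}" "0 \<le> c"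
    and "\<And>T. T \<in> I \<rightarrow>\<^sub>E A \<Longrightarrow> avg A (\<lambda>t. F (T(i := t))) \<le> c"
  shows "avg (I \<rightarrow>\<^sub>E A) F \<le> c"
  by (subst avg_resample[OF assms(1-3)]) (rule avg_le[OF assms(5,4)])

section \<open>Simulating the sampling oracle\<close>

text \<open>Rejection sampling made deterministic: the list holds candidate points, those with
  \<open>f\<close> false are skipped, and a strategy that still wants samples at the end of the list
  stays a \<open>Draw\<close>. The values of \<open>f\<close> are read only at candidates.\<close>

primrec final :: "(point \<Rightarrow> bool) \<Rightarrow> point list \<Rightarrow> strategy \<Rightarrow> strategy" where
  "final f [] S = S"
| "final f (z # zs) S =
     (case S of Draw s \<Rightarrow> if f z then final f zs (s z) else final f zs S | Ask xs d \<Rightarrow> S)"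

primrec asked :: "strategy \<Rightarrow> point list" where
  "asked (Draw s) = []"
| "asked (Ask xs d) = xs"

text \<open>A simulation that has run out of candidates counts as rejection, so simulating can only
  lose acceptance probability.\<close>

primrec verdict :: "(point \<Rightarrow> bool) \<Rightarrow> strategy \<Rightarrow> bool" where
  "verdict f (Draw s) = False"
| "verdict f (Ask xs d) = d (map f xs)"

lemma final_Ask [simp]: "final f zs (Ask xs d) = Ask xs d"
  by (cases zs) auto

lemma final_cong: "(\<And>z. z \<in> set zs \<Longrightarrow> f z = g z) \<Longrightarrow> final f zs S = final g zs S"
  by (induction zs arbitrary: S) (auto split: strategy.split)

lemma verdict_cong: "(\<And>x. x \<in> set (asked S) \<Longrightarrow> f x = g x) \<Longrightarrow> verdict f S = verdict g S"
  by (cases S) (auto cong: map_cong)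

lemma asked_final:
  "query_bound n S q \<Longrightarrow> set zs \<subseteq> cube n \<Longrightarrow>
     set (asked (final f zs S)) \<subseteq> cube n \<and> length (asked (final f zs S)) \<le> q"
proof (induction zs arbitrary: S q)
  case Nil
  then show ?case by (cases S) auto
next
  case (Cons z zs)
  show ?case
  proof (cases S)
    case (Draw s)
    have "query_bound n (s z) (q - 1)" using Cons.prems Draw by auto
    then have "set (asked (final f zs (s z))) \<subseteq> cube n \<and> length (asked (final f zs (s z))) \<le> q - 1"
      using Cons.prems by (intro Cons.IH) auto
    moreover have "set (asked (final f zs S)) \<subseteq> cube n \<and> length (asked (final f zs S)) \<le> q"
      using Cons.prems by (intro Cons.IH) auto
    ultimately show ?thesis using Draw by auto
  qed (use Cons.prems in auto)
qed

section \<open>Uniform candidate lists and the simulated acceptance probability\<close>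

definition samples :: "point set \<Rightarrow> nat \<Rightarrow> point list set" where
  "samples V R = {zs. set zs \<subseteq> V \<and> length zs = R}"

lemma samples_0 [simp]: "samples V 0 = {[]}"
  by (auto simp: samples_def)

lemma samples_Suc: "samples V (Suc R) = (\<lambda>(z, zs). z # zs) ` (V \<times> samples V R)"
  by (auto simp: samples_def length_Suc_conv image_iff)

lemma finite_samples: "finite V \<Longrightarrow> finite (samples V R)"
  unfolding samples_def by (rule finite_lists_length_eq)

lemma samples_nonempty: "V \<noteq> {} \<Longrightarrow> samples V R \<noteq> {}"
  by (induction R) (auto simp: samples_Suc)

lemma avg_samples_Suc:
  "avg (samples V (Suc R)) F = avg V (\<lambda>z. avg (samples V R) (\<lambda>zs. F (z # zs)))"
proof -
  have inj: "inj_on (\<lambda>(z, zs). z # zs) (V \<times> samples V R)" by (auto simp: inj_on_def)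
  show ?thesis
    unfolding avg_def samples_Suc card_image[OF inj] sum.reindex[OF inj]
    by (simp add: sum.cartesian_product card_cartesian_product
        sum_divide_distrib[symmetric] case_prod_unfold o_def mult.commute)
qed

abbreviation accept_prob :: "nat \<Rightarrow> (point \<Rightarrow> bool) \<Rightarrow> strategy \<Rightarrow> real" where
  "accept_prob n f S \<equiv> pmf (run n f S) True"

definition sim_prob :: "(point \<Rightarrow> bool) \<Rightarrow> point set \<Rightarrow> nat \<Rightarrow> strategy \<Rightarrow> real" where
  "sim_prob f V R S = avg (samples V R) (\<lambda>zs. of_bool (verdict f (final f zs S)))"

lemma accept_prob_Draw:
  "ones n f \<noteq> {} \<Longrightarrow> accept_prob n f (Draw s) = avg (ones n f) (\<lambda>x. accept_prob n f (s x))"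
  by (simp add: avg_def pmf_bind_pmf_of_set ones_def finite_cube)

lemma sim_prob_Ask:
  "finite V \<Longrightarrow> V \<noteq> {} \<Longrightarrow> sim_prob f V R (Ask xs d) = of_bool (d (map f xs))"
  by (simp add: sim_prob_def avg_const finite_samples samples_nonempty)

lemma sim_prob_Draw_0: "sim_prob f V 0 (Draw s) = 0"
  by (simp add: sim_prob_def avg_def)

text \<open>The first candidate succeeds with probability \<open>r\<close> and is then uniform in
  \<open>W\<close>; a failure uses up one trial and leaves the strategy unchanged.\<close>

lemma sim_prob_Draw_Suc:
  assumes V: "finite V" "V \<noteq> {}" and W: "W = {z \<in> V. f z}" "W \<noteq> {}" and r: "r = card W / card V"
  shows "sim_prob f V (Suc R) (Draw s) =
    r * avg W (\<lambda>z. sim_prob f V R (s z)) + (1 - r) * sim_prob f V R (Draw s)"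
proof -
  have WV: "W \<subseteq> V" using W by auto
  have fW: "finite W" "card W > 0" "card V > 0" using V W by (auto simp: card_gt_0_iff)
  have cV: "real (card (V \<inter> - W)) = real (card V) - real (card W)"
  proof -
    have "V \<inter> - W = V - W" by auto
    moreover have "card (V - W) = card V - card W" "card W \<le> card V"
      using V W by (auto intro: card_Diff_subset card_mono fW)
    ultimately show ?thesis by simp
  qed
  have "sim_prob f V (Suc R) (Draw s) =
      avg V (\<lambda>z. if z \<in> W then sim_prob f V R (s z) else sim_prob f V R (Draw s))"
    unfolding sim_prob_def avg_samples_Suc using W by (intro avg_cong) auto
  also have "\<dots> = ((\<Sum>z\<in>W. sim_prob f V R (s z)) + real (card (V \<inter> - W)) * sim_prob f V R (Draw s)) / card V"
    using V WV by (simp add: avg_def sum.If_cases Int_absorb1)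
  also have "\<dots> = r * avg W (\<lambda>z. sim_prob f V R (s z)) + (1 - r) * sim_prob f V R (Draw s)"
    using fW by (simp add: r avg_def field_simps cV)
  finally show ?thesis .
qed

text \<open>Rejection sampling from \<open>V\<close>. The error term is the exponential-moment bound on the probability that
  \<open>R\<close> trials of success probability at least \<open>\<rho>\<close> contain fewer than \<open>q\<close> successes.\<close>

lemma simulation:
  fixes \<rho> :: real
  assumes V: "V \<subseteq> cube n" "ones n f \<subseteq> V"
    and rho: "0 < \<rho>" "\<rho> * card V \<le> card (ones n f)"
    and ne: "ones n f \<noteq> {}"
    and "query_bound n S q"
  shows "accept_prob n f S - 2 ^ q * (1 - \<rho> / 2) ^ R \<le> sim_prob f V R S \<and> sim_prob f V R S \<le> accept_prob n f S"
  using \<open>query_bound n S q\<close>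
proof (induction R arbitrary: S q)
  have V': "finite V" "V \<noteq> {}" using V ne finite_subset[OF _ finite_cube] by auto
  have W: "ones n f = {z \<in> V. f z}" using V by (auto simp: ones_def)
  have cle: "card (ones n f) \<le> card V" using V V' by (intro card_mono)
  have cV: "real (card V) > 0" using V' by (simp add: card_gt_0_iff)
  define r where "r = card (ones n f) / card V"
  have r: "\<rho> \<le> r" "r \<le> 1" using rho cle cV by (auto simp: r_def field_simps)
  {
    case 0
    show ?case
    proof (cases S)
      case (Draw s)
      have "accept_prob n f S \<le> 1" by (rule pmf_le_1)
      moreover have "(1::real) \<le> 2 ^ q" by simp
      ultimately have "accept_prob n f S \<le> 2 ^ q" by linarith
      then show ?thesis using Draw by (simp add: sim_prob_Draw_0 del: run.simps)
    qed (use V' r rho in \<open>simp add: sim_prob_Ask\<close>)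
  next
    case (Suc R)
    show ?case
    proof (cases S)
      case (Draw s)
      let ?O = "ones n f"
      let ?d = "\<lambda>q. 2 ^ q * (1 - \<rho> / 2) ^ R"
      obtain p where p: "q = Suc p" using Suc.prems Draw by (cases q) auto
      have fO: "finite ?O" using V' V finite_subset by blast
      have qb: "query_bound n (s z) p" if "z \<in> ?O" for z
        using that Suc.prems Draw p V by auto
      have a: "accept_prob n f S = avg ?O (\<lambda>x. accept_prob n f (s x))"
        using accept_prob_Draw[OF ne] Draw by simp
      have e: "sim_prob f V (Suc R) S =
          r * avg ?O (\<lambda>z. sim_prob f V R (s z)) + (1 - r) * sim_prob f V R S"
        using sim_prob_Draw_Suc[OF V' W ne r_def] Draw by simp
      have up: "avg ?O (\<lambda>z. sim_prob f V R (s z)) \<le> accept_prob n f S"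
        unfolding a using Suc.IH[OF qb] by (intro avg_mono) auto
      have "avg ?O (\<lambda>z. accept_prob n f (s z) - ?d p) \<le> avg ?O (\<lambda>z. sim_prob f V R (s z))"
        using Suc.IH[OF qb] by (intro avg_mono) auto
      then have lo: "accept_prob n f S - ?d p \<le> avg ?O (\<lambda>z. sim_prob f V R (s z))"
        unfolding a avg_diff avg_const[OF fO ne] .
      have IH: "accept_prob n f S - ?d q \<le> sim_prob f V R S" "sim_prob f V R S \<le> accept_prob n f S"
        using Suc.IH[OF Suc.prems] by auto
      have "sim_prob f V (Suc R) S \<le> r * accept_prob n f S + (1 - r) * accept_prob n f S"
        unfolding e using r rho up IH by (intro add_mono mult_left_mono) auto
      then have 1: "sim_prob f V (Suc R) S \<le> accept_prob n f S" by (simp add: algebra_simps)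
      have "r * (accept_prob n f S - ?d p) + (1 - r) * (accept_prob n f S - ?d q) \<le> sim_prob f V (Suc R) S"
        unfolding e using r rho lo IH by (intro add_mono mult_left_mono) auto
      then have 2: "accept_prob n f S - (r * ?d p + (1 - r) * ?d q) \<le> sim_prob f V (Suc R) S"
        by (simp add: algebra_simps)
      \<comment> \<open>With \<open>q = Suc p\<close> the error for \<open>p\<close> is half the
        error for \<open>q\<close>. The mixture therefore carries the factor
        \<open>r / 2 + (1 - r) = 1 - r / 2\<close>, at most \<open>1 - \<rho> / 2\<close>.\<close>
      have "0 \<le> 2 ^ p * (1 - \<rho> / 2) ^ R" using r rho by simp
      then have "(1 - r / 2) * (2 * (2 ^ p * (1 - \<rho> / 2) ^ R)) \<le> (1 - \<rho> / 2) * (2 * (2 ^ p * (1 - \<rho> / 2) ^ R))"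
        using r by (intro mult_right_mono) auto
      then have "r * ?d p + (1 - r) * ?d q \<le> 2 ^ q * (1 - \<rho> / 2) ^ Suc R"
        unfolding p by (simp add: algebra_simps)
      then show ?thesis using 1 2 by linarith
    qed (use V' r rho in \<open>simp add: sim_prob_Ask\<close>)
  }
qed

section \<open>The two random functions\<close>

definition weight :: "nat \<Rightarrow> point \<Rightarrow> nat" where
  "weight n x = card {j. j < n \<and> x j}"

lemma weight_mono: "x \<le> y \<Longrightarrow> weight n x \<le> weight n y"
  unfolding weight_def by (intro card_mono) (auto simp: le_fun_def)

lemma weight_upd:
  assumes "j < n" "\<not> x j"
  shows "weight n (x(j := True)) = Suc (weight n x)"
proof -
  have "{i. i < n \<and> (x(j := True)) i} = insert j {i. i < n \<and> x i}" using assms(1) by auto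
  then show ?thesis using assms(2) by (simp add: weight_def)
qed

lemma cube_upd: "x \<in> cube n \<Longrightarrow> j < n \<Longrightarrow> x(j := c) \<in> cube n"
  by (auto simp: cube_def PiE_iff extensional_def)

text \<open>\<open>n\<close> is the dimension, \<open>L\<close> the lowest of the three random
  layers and \<open>M\<close> the number of terms.\<close>

locale talagrand =
  fixes n L M :: nat
begin

definition live :: "point \<Rightarrow> bool" where
  "live x \<longleftrightarrow> L \<le> weight n x \<and> weight n x \<le> L + 2"

text \<open>A term lists \<open>n\<close> variables drawn with replacement. Allowing repetitions
  makes a point of weight \<open>w\<close> satisfy a random term with probability exactly
  \<open>(w / n) ^ n\<close>.\<close>

definition sat :: "(nat \<Rightarrow> nat) \<Rightarrow> point \<Rightarrow> bool" where
  "sat t x \<longleftrightarrow> (\<forall>a<n. x (t a))"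

definition cov :: "(nat \<Rightarrow> nat \<Rightarrow> nat) \<Rightarrow> point \<Rightarrow> nat set" where
  "cov T x = {i. i < M \<and> sat (T i) x}"

text \<open>The common shape of both cases. Two satisfied terms already force the value 1, so
  \<open>v\<close> decides only at live points with exactly one satisfied term.\<close>

definition fn :: "(nat \<Rightarrow> nat \<Rightarrow> nat) \<Rightarrow> (nat \<Rightarrow> point \<Rightarrow> bool) \<Rightarrow> point \<Rightarrow> bool" where
  "fn T v x \<longleftrightarrow> L + 2 < weight n x \<or>
     (L \<le> weight n x \<and> ((\<exists>i\<in>cov T x. v i x) \<or> (\<exists>i\<in>cov T x. \<exists>j\<in>cov T x. i \<noteq> j)))"

definition yes :: "(nat \<Rightarrow> nat \<Rightarrow> nat) \<Rightarrow> nat set \<Rightarrow> point \<Rightarrow> bool" where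
  "yes T b = fn T (\<lambda>i x. i \<in> b)"

text \<open>The two keys of a term may coincide; the parity is then constantly false, and
  \<open>bases\<close> excludes this case.\<close>

definition parity :: "(nat \<Rightarrow> nat \<times> nat) \<Rightarrow> nat \<Rightarrow> point \<Rightarrow> bool" where
  "parity K i x \<longleftrightarrow> x (fst (K i)) \<noteq> x (snd (K i))"

definition no :: "(nat \<Rightarrow> nat \<Rightarrow> nat) \<Rightarrow> (nat \<Rightarrow> nat \<times> nat) \<Rightarrow> nat set \<Rightarrow> point \<Rightarrow> bool" where
  "no T K b = fn T (\<lambda>i x. (i \<in> b) \<noteq> parity K i x)"

abbreviation "TT \<equiv> {..<M} \<rightarrow>\<^sub>E ({..<n} \<rightarrow>\<^sub>E {..<n})"
abbreviation "KK \<equiv> {..<M} \<rightarrow>\<^sub>E ({..<n} \<times> {..<n})"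
abbreviation "BB \<equiv> Pow {..<M}"

section \<open>Terms along the cube order and the monotone case\<close>

lemma sat_mono: "sat t x \<Longrightarrow> x \<le> y \<Longrightarrow> sat t y"
  by (auto simp: sat_def le_fun_def)

lemma cov_mono: "x \<le> y \<Longrightarrow> cov T x \<subseteq> cov T y"
  by (auto simp: cov_def intro: sat_mono)

lemma fn_cong:
  assumes "\<And>i. live x \<Longrightarrow> cov T x = {i} \<Longrightarrow> v i x = v' i x"
  shows "fn T v x = fn T v' x"
proof (cases "\<exists>i. cov T x = {i}")
  case True
  then show ?thesis using assms by (auto simp: fn_def live_def not_less)
next
  case False
  then have "cov T x = {} \<or> (\<exists>i\<in>cov T x. \<exists>j\<in>cov T x. i \<noteq> j)" by auto
  then show ?thesis by (auto simp: fn_def)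
qed

lemma fn_unique: "live x \<Longrightarrow> cov T x = {i} \<Longrightarrow> fn T v x = v i x"
  by (auto simp: fn_def live_def)

lemma mono_yes: "mono_on (cube n) (yes T b)"
proof (rule mono_onI)
  fix x y :: point assume "x \<le> y"
  then have "weight n x \<le> weight n y" "cov T x \<subseteq> cov T y"
    by (auto intro!: weight_mono cov_mono)
  then show "yes T b x \<le> yes T b y"
    unfolding yes_def fn_def le_bool_def by (meson le_trans less_le_trans subsetD)
qed

text \<open>That term \<open>i\<close> is the only one is demanded at the top of the chain. Together
  with \<open>sat (T i) x\<close> and \<open>cov_mono\<close> this gives it at all three
  points.\<close>

definition bases :: "(nat \<Rightarrow> nat \<Rightarrow> nat) \<Rightarrow> (nat \<Rightarrow> nat \<times> nat) \<Rightarrow> point set" where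
  "bases T K = {x \<in> cube n. weight n x = L \<and> (\<exists>i<M. sat (T i) x \<and> fst (K i) \<noteq> snd (K i) \<and>
     \<not> x (fst (K i)) \<and> \<not> x (snd (K i)) \<and> cov T (x(fst (K i) := True, snd (K i) := True)) = {i})}"

text \<open>Along \<open>x \<le> x + e\<^sub>k \<le> x + e\<^sub>k + e\<^sub>l\<close> the function \<open>no\<close> takes the values \<open>c, \<not> c, c\<close>, so whatever the
  bit \<open>c\<close> is, one of the two edges is violated.\<close>

lemma bases_violated:
  assumes K: "K \<in> KK" and g: "mono_on (cube n) g" and x: "x \<in> bases T K"
  obtains y i where "y \<in> cube n" "cov T y = {i}" "no T K b y \<noteq> g y"
    "y(fst (K i) := False, snd (K i) := False) = x"
proof -
  from x obtain i where xc: "x \<in> cube n" and w: "weight n x = L" and i: "i < M" "sat (T i) x"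
    and kl: "fst (K i) \<noteq> snd (K i)" "\<not> x (fst (K i))" "\<not> x (snd (K i))"
    and c: "cov T (x(fst (K i) := True, snd (K i) := True)) = {i}"
    unfolding bases_def by auto
  define k l where "k = fst (K i)" and "l = snd (K i)"
  have kn: "k < n" "l < n" using K i(1) by (auto simp: k_def l_def PiE_iff mem_Times_iff)
  define y z where "y = x(k := True)" and "z = y(l := True)"
  have le: "x \<le> y" "y \<le> z" by (auto simp: y_def z_def le_fun_def)
  have yz: "y \<in> cube n" "z \<in> cube n" using xc kn by (auto simp: y_def z_def intro!: cube_upd)
  have cz: "cov T z = {i}" using c by (simp add: z_def y_def k_def l_def)
  have cx: "cov T x = {i}" "cov T y = {i}"
    using cov_mono[OF le(1), of T] cov_mono[OF le(2), of T] cz i by (auto simp: cov_def)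
  have wy: "weight n y = L + 1" "weight n z = L + 2"
    using kn kl w weight_upd[of k n x] weight_upd[of l n y] by (auto simp: y_def z_def k_def l_def)
  have lv: "live x" "live y" "live z" using w wy by (auto simp: live_def)
  have "parity K i x = False" "parity K i y = True" "parity K i z = False"
    using kl by (auto simp: parity_def y_def z_def k_def l_def)
  then have v: "no T K b x = (i \<in> b)" "no T K b y = (i \<notin> b)" "no T K b z = (i \<in> b)"
    using fn_unique lv cx cz by (auto simp: no_def)
  have "g x \<le> g y" "g y \<le> g z"
    using g le xc yz by (auto dest: mono_onD)
  then have "no T K b x \<noteq> g x \<or> no T K b y \<noteq> g y \<or> no T K b z \<noteq> g z"
    using v by auto
  moreover have "x(k := False, l := False) = x" "y(k := False, l := False) = x"
    "z(k := False, l := False) = x"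
    using kl by (auto simp: y_def z_def k_def l_def fun_eq_iff)
  ultimately show ?thesis using that xc yz cx cz unfolding k_def l_def by metis
qed

text \<open>Different bases give different disagreements, because a disagreement \<open>y\<close>
  found by \<open>bases_violated\<close> determines its base: its only satisfied term names the key
  pair, and clearing these two coordinates leads back to the base.\<close>

lemma card_bases_le:
  assumes K: "K \<in> KK" and g: "mono_on (cube n) g"
  shows "card (bases T K) \<le> card (sym_diff (ones n (no T K b)) (ones n g))"
proof -
  define base where "base y = (let i = THE i. cov T y = {i} in y(fst (K i) := False, snd (K i) := False))"
    for y :: point
  have "bases T K \<subseteq> base ` sym_diff (ones n (no T K b)) (ones n g)"
  proof
    fix x assume "x \<in> bases T K"
    then obtain y i where y: "y \<in> cube n" "cov T y = {i}" "no T K b y \<noteq> g y"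
      "y(fst (K i) := False, snd (K i) := False) = x"
      using bases_violated[OF K g] by metis
    then have "base y = x" by (simp add: base_def)
    moreover have "y \<in> sym_diff (ones n (no T K b)) (ones n g)"
      using y by (auto simp: ones_def)
    ultimately show "x \<in> base ` sym_diff (ones n (no T K b)) (ones n g)" by blast
  qed
  moreover have "finite (sym_diff (ones n (no T K b)) (ones n g))"
    by (auto simp: ones_def finite_cube)
  ultimately show ?thesis by (rule surj_card_le[rotated])
qed

text \<open>Rejected candidates are included, because rejecting a point reveals the value there as
  well.\<close>

definition seen :: "(nat \<Rightarrow> nat \<Rightarrow> nat) \<Rightarrow> nat set \<Rightarrow> point list \<Rightarrow> strategy \<Rightarrow> point set" where
  "seen T b zs S = set zs \<union> set (asked (final (yes T b) zs S))"

definition conflict :: "(nat \<Rightarrow> nat \<Rightarrow> nat) \<Rightarrow> (nat \<Rightarrow> nat \<times> nat) \<Rightarrow> point set \<Rightarrow> bool" where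
  "conflict T K P \<longleftrightarrow> (\<exists>i<M. \<exists>x\<in>P. \<exists>y\<in>P. live x \<and> live y \<and> cov T x = {i} \<and> cov T y = {i} \<and>
     parity K i x \<noteq> parity K i y)"

text \<open>If the seen points of each term agree on the parity of that term, then shifting the bits by these
  parities makes \<open>no\<close> answer as \<open>yes\<close>. The shift can be undone because the answers determine the seen
  points.\<close>

lemma coupling:
  "card {b \<in> BB. verdict (yes T b) (final (yes T b) zs S)}
     \<le> card {b \<in> BB. verdict (no T K b) (final (no T K b) zs S)} + card {b \<in> BB. conflict T K (seen T b zs S)}"
    (is "card ?Y \<le> card ?N + card ?C")
proof -
  define c where "c P = {i. i < M \<and> (\<exists>x\<in>P. live x \<and> cov T x = {i} \<and> parity K i x)}" for P
  define \<phi> where "\<phi> b = sym_diff b (c (seen T b zs S))" for b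
  have agree: "no T K (\<phi> b) x = yes T b x" if nc: "\<not> conflict T K (seen T b zs S)" and x: "x \<in> seen T b zs S" for b x
    unfolding no_def yes_def
  proof (rule fn_cong)
    fix i assume lx: "live x" "cov T x = {i}"
    then have iM: "i < M" by (auto simp: cov_def)
    have "parity K i y = parity K i x" if "y \<in> seen T b zs S" "live y" "cov T y = {i}" for y
      using nc iM x lx that unfolding conflict_def by blast
    then have "i \<in> c (seen T b zs S) \<longleftrightarrow> parity K i x"
      unfolding c_def using iM x lx by blast
    then show "((i \<in> \<phi> b) \<noteq> parity K i x) = (i \<in> b)" by (auto simp: \<phi>_def)
  qed
  have fin: "final (no T K (\<phi> b)) zs S = final (yes T b) zs S" if "\<not> conflict T K (seen T b zs S)" for b
    using agree[OF that] by (intro final_cong) (auto simp: seen_def)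
  have inj: "inj_on \<phi> (?Y - ?C)"
  proof (rule inj_onI)
    fix b b' assume b: "b \<in> ?Y - ?C" "b' \<in> ?Y - ?C" and eq: "\<phi> b = \<phi> b'"
    \<comment> \<open>Equal shifted bits give one and the same \<open>no\<close> function. By
      \<open>fin\<close> both \<open>yes\<close> runs coincide with its run, so they see the same
      points and were shifted by the same set.\<close>
    have "final (yes T b) zs S = final (yes T b') zs S"
      using fin[of b] fin[of b'] b eq by auto
    then have "seen T b zs S = seen T b' zs S" by (simp add: seen_def)
    with eq have "sym_diff b C = sym_diff b' C" if "C = c (seen T b zs S)" for C
      using that by (simp add: \<phi>_def)
    then show "b = b'" by blast
  qed
  have "\<phi> ` (?Y - ?C) \<subseteq> ?N"
  proof (rule image_subsetI)
    fix b assume b: "b \<in> ?Y - ?C"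
    then have nc: "\<not> conflict T K (seen T b zs S)" by auto
    have "verdict (no T K (\<phi> b)) (final (yes T b) zs S) = verdict (yes T b) (final (yes T b) zs S)"
      using agree[OF nc] by (intro verdict_cong) (auto simp: seen_def)
    then show "\<phi> b \<in> ?N" using b fin[OF nc] by (auto simp: \<phi>_def c_def)
  qed
  then have "card (?Y - ?C) \<le> card ?N"
    by (intro card_inj_on_le[OF inj]) auto
  moreover have "card ?Y \<le> card (?Y - ?C) + card ?C"
    by (rule order_trans[OF _ card_Un_le]) (intro card_mono, auto)
  ultimately show ?thesis by linarith
qed

end

section \<open>The answers rarely separate the two cases\<close>

definition meet :: "nat \<Rightarrow> point \<Rightarrow> point \<Rightarrow> nat" where
  "meet n x y = card {j. j < n \<and> x j \<and> y j}"

definition diff :: "nat \<Rightarrow> point \<Rightarrow> point \<Rightarrow> nat set" where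
  "diff n x y = {j. j < n \<and> x j \<noteq> y j}"

lemma meet_commute: "meet n x y = meet n y x"
  by (simp add: meet_def conj_commute)

lemma card_diff: "weight n x + weight n y = card (diff n x y) + 2 * meet n x y"
proof -
  let ?A = "{j. j < n \<and> x j}" and ?B = "{j. j < n \<and> y j}"
  have fin: "finite ?A" "finite ?B" by auto
  have "card (?A \<union> ?B) = card (diff n x y \<union> (?A \<inter> ?B))"
    by (rule arg_cong[of _ _ card]) (auto simp: diff_def)
  also have "\<dots> = card (diff n x y) + card (?A \<inter> ?B)"
    by (rule card_Un_disjoint) (auto simp: diff_def)
  finally have "card ?A + card ?B = card (diff n x y) + 2 * card (?A \<inter> ?B)"
    using card_Un_Int[OF fin] by simp
  moreover have "?A \<inter> ?B = {j. j < n \<and> x j \<and> y j}" by auto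
  ultimately show ?thesis by (simp add: weight_def meet_def)
qed

text \<open>Listing the elements of \<open>A\<close> and padding with the outside value
  \<open>n\<close> encodes \<open>A\<close> by a list of length exactly \<open>m\<close> over
  \<open>n + 1\<close> symbols.\<close>

lemma card_small_subsets: "card {A. A \<subseteq> {..<n} \<and> card A \<le> m} \<le> (n + 1) ^ m"
proof -
  let ?X = "{xs. set xs \<subseteq> {..n} \<and> length xs = m}"
  have "{A. A \<subseteq> {..<n} \<and> card A \<le> m} \<subseteq> (\<lambda>xs. set xs \<inter> {..<n}) ` ?X"
  proof
    fix A assume "A \<in> {A. A \<subseteq> {..<n} \<and> card A \<le> m}"
    then have A: "A \<subseteq> {..<n}" "card A \<le> m" "finite A" using finite_subset by auto
    let ?xs = "sorted_list_of_set A @ replicate (m - card A) n"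
    have "?xs \<in> ?X" using A by auto
    moreover have "A = set ?xs \<inter> {..<n}" using A by auto
    ultimately show "A \<in> (\<lambda>xs. set xs \<inter> {..<n}) ` ?X" by blast
  qed
  then have "card {A. A \<subseteq> {..<n} \<and> card A \<le> m} \<le> card ?X"
    by (intro surj_card_le) (auto intro: finite_lists_length_eq)
  then show ?thesis by (simp add: card_lists_length_eq)
qed

context talagrand
begin

abbreviation "tup \<equiv> {..<n} \<rightarrow>\<^sub>E {..<n}"

text \<open>Farness is measured by common ones because two points satisfy a random term together
  with probability \<open>(meet n x y / n) ^ n\<close>. The lemma \<open>near_diff\<close>
  translates closeness of live points into Hamming distance.\<close>

definition far :: "nat \<Rightarrow> point \<Rightarrow> point \<Rightarrow> bool" where
  "far D x y \<longleftrightarrow> meet n x y + D \<le> L"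

lemma far_commute: "far D x y = far D y x"
  by (simp add: far_def meet_commute)

lemma near_diff:
  assumes "live x" "live y" "\<not> far D x y"
  shows "card (diff n x y) \<le> 2 * D + 4"
  using assms card_diff[of n x y] by (simp add: live_def far_def)

lemma card_sat2: "card {t \<in> tup. sat t x \<and> sat t y} = meet n x y ^ n"
proof -
  have "{t \<in> tup. sat t x \<and> sat t y} = {..<n} \<rightarrow>\<^sub>E {j. j < n \<and> x j \<and> y j}"
    unfolding sat_def PiE_def Pi_def by blast
  then show ?thesis by (simp add: card_PiE meet_def)
qed

lemma card_sat2_far: "far D x y \<Longrightarrow> card {t \<in> tup. sat t x \<and> sat t y} \<le> (L - D) ^ n"
  unfolding card_sat2 far_def by (intro power_mono) auto

lemma yes_cong:
  assumes "live x \<Longrightarrow> cov T x = cov T' x"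
  shows "yes T b x = yes T' b x"
proof (cases "live x")
  case True
  then show ?thesis using assms by (simp add: yes_def fn_def)
next
  case False
  then show ?thesis by (auto simp: yes_def fn_def live_def)
qed

text \<open>Without a clash each term has a centre: the live sample satisfying it or, if there is
  none, any live query that does. The last case is confined to terms satisfied by no live sample, so
  that its queries come from one set independent of \<open>t\<close>.\<close>

definition clash :: "nat \<Rightarrow> point set \<Rightarrow> point set \<Rightarrow> (nat \<Rightarrow> nat) \<Rightarrow> bool" where
  "clash D Z Q t \<longleftrightarrow>
     (\<exists>x\<in>Z. \<exists>y\<in>Z. live x \<and> live y \<and> x \<noteq> y \<and> sat t x \<and> sat t y) \<or>
     (\<exists>z\<in>Z. \<exists>p\<in>Q. live z \<and> live p \<and> sat t z \<and> sat t p \<and> far D z p) \<or>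
     ((\<forall>z\<in>Z. live z \<longrightarrow> \<not> sat t z) \<and>
      (\<exists>p\<in>Q. \<exists>p'\<in>Q. live p \<and> live p' \<and> sat t p \<and> sat t p' \<and> far D p p'))"

definition separated :: "nat \<Rightarrow> point set \<Rightarrow> bool" where
  "separated D Z \<longleftrightarrow> (\<forall>x\<in>Z. \<forall>y\<in>Z. live x \<longrightarrow> live y \<longrightarrow> x \<noteq> y \<longrightarrow> far D x y)"

abbreviation queries :: "(nat \<Rightarrow> nat \<Rightarrow> nat) \<Rightarrow> nat set \<Rightarrow> point list \<Rightarrow> strategy \<Rightarrow> point set" where
  "queries T b zs S \<equiv> set (asked (final (yes T b) zs S))"

text \<open>The queries depend on the term \<open>t\<close> only through the set of live points of \<open>zs\<close> satisfying \<open>t\<close>.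
  Apart from a rare event this set is empty or a singleton, which leaves few pairs of points that could
  clash, each of them chosen independently of \<open>t\<close>.\<close>

lemma clash_prob:
  assumes sep: "separated D (set zs)" and R: "length zs = R" "set zs \<subseteq> cube n"
    and S: "query_bound n S q" and i: "i < M"
  shows "avg tup (\<lambda>t. of_bool (clash D (set zs) (queries (T(i := t)) b zs S) t))
     \<le> real ((R + q)\<^sup>2) * (real (L - D) / real n) ^ n"
proof -
  let ?Z = "set zs"
  define touch where "touch t = {z \<in> ?Z. live z \<and> sat t z}" for t
  define Q where "Q t = queries (T(i := t)) b zs S" for t
  \<comment> \<open>\<open>Qf\<close> factors \<open>Q\<close> through \<open>touch\<close>. At a
    set \<open>Y\<close> that is not of the form \<open>touch t\<close> the choice is arbitrary,
    which is harmless because the bound on \<open>card (Q t)\<close> holds for all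
    \<open>t\<close>.\<close>
  define Qf where "Qf Y = Q (SOME t. touch t = Y)" for Y
  have Q_eq: "Q t = Q t'" if "touch t = touch t'" for t t'
  proof -
    have "yes (T(i := t)) b z = yes (T(i := t')) b z" if "z \<in> ?Z" for z
    proof (rule yes_cong)
      assume "live z"
      with that \<open>touch t = touch t'\<close> have "sat t z = sat t' z" by (auto simp: touch_def)
      then show "cov (T(i := t)) z = cov (T(i := t')) z" by (simp add: cov_def)
    qed
    then have "final (yes (T(i := t)) b) zs S = final (yes (T(i := t')) b) zs S"
      by (rule final_cong)
    then show ?thesis by (simp add: Q_def)
  qed
  have Qf: "Qf (touch t) = Q t" for t
    unfolding Qf_def by (rule Q_eq, rule someI[of "\<lambda>t'. touch t' = touch t"], rule refl)
  have cQ: "card (Q t) \<le> q" "finite (Q t)" for t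
    using asked_final[OF S R(2)] order_trans[OF card_length] unfolding Q_def by blast+
  then have cQf: "card (Qf Y) \<le> q" "finite (Qf Y)" for Y by (auto simp: Qf_def)
  have cZ: "card ?Z \<le> R" using R card_length by auto
  \<comment> \<open>Fixed pairs that cover every clash: two samples, a sample \<open>z\<close> with
    a query made when \<open>z\<close> alone is touched, and two queries made when no sample is
    touched.\<close>
  define \<P> where "\<P> = ?Z \<times> ?Z \<union> (SIGMA z:?Z. Qf {z}) \<union> Qf {} \<times> Qf {}"
  have fin\<P>: "finite \<P>" using cQf by (auto simp: \<P>_def)
  have "card \<P> \<le> card (?Z \<times> ?Z) + card (SIGMA z:?Z. Qf {z}) + card (Qf {} \<times> Qf {})"
    unfolding \<P>_def by (meson card_Un_le order_trans add_mono order_refl)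
  also have "\<dots> \<le> R * R + R * q + q * q"
  proof (intro add_mono)
    show "card (?Z \<times> ?Z) \<le> R * R" using cZ by (simp add: card_cartesian_product mult_mono)
    have "card (SIGMA z:?Z. Qf {z}) = (\<Sum>z\<in>?Z. card (Qf {z}))" using cQf by (intro card_SigmaI) auto
    also have "\<dots> \<le> card ?Z * q" using cQf by (intro sum_bounded_above[THEN order_trans]) auto
    finally show "card (SIGMA z:?Z. Qf {z}) \<le> R * q" using cZ by (meson mult_le_mono1 order_trans)
    show "card (Qf {} \<times> Qf {}) \<le> q * q" using cQf by (simp add: card_cartesian_product mult_mono)
  qed
  also have "\<dots> \<le> (R + q)\<^sup>2" by (simp add: power2_eq_square algebra_simps)
  finally have c\<P>: "card \<P> \<le> (R + q)\<^sup>2" .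
  let ?A = "\<lambda>(x, y). {t \<in> tup. sat t x \<and> sat t y}"
  let ?F = "{u \<in> \<P>. far D (fst u) (snd u)}"
  have sub: "{t \<in> tup. clash D ?Z (Q t) t} \<subseteq> (\<Union>u\<in>?F. ?A u)"
  proof
    fix t assume "t \<in> {t \<in> tup. clash D ?Z (Q t) t}"
    then have t: "t \<in> tup" "clash D ?Z (Q t) t" by auto
    have "\<exists>x y. (x, y) \<in> \<P> \<and> far D x y \<and> sat t x \<and> sat t y"
    proof (cases "\<exists>x\<in>?Z. \<exists>y\<in>?Z. live x \<and> live y \<and> x \<noteq> y \<and> sat t x \<and> sat t y")
      case True
      then show ?thesis using sep unfolding separated_def \<P>_def by blast
    next
      case uniq: False
      show ?thesis
      proof (cases "\<exists>z\<in>?Z. live z \<and> sat t z")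
        case True
        with t(2) uniq obtain z p where z: "z \<in> ?Z" "live z" "sat t z" and p: "p \<in> Q t" "sat t p" "far D z p"
          unfolding clash_def by blast
        from z uniq have "touch t = {z}" by (auto simp: touch_def)
        with Qf[of t] p have "p \<in> Qf {z}" by simp
        then have "(z, p) \<in> \<P>" using z by (auto simp: \<P>_def)
        then show ?thesis using z p by blast
      next
        case False
        then have "touch t = {}" by (auto simp: touch_def)
        with Qf[of t] have "Q t = Qf {}" by simp
        moreover from False t(2) obtain p p' where "p \<in> Q t" "p' \<in> Q t" "sat t p" "sat t p'" "far D p p'"
          unfolding clash_def by blast
        ultimately have "(p, p') \<in> \<P>" "far D p p'" "sat t p" "sat t p'" by (auto simp: \<P>_def)
        then show ?thesis by blast
      qed
    qed
    then show "t \<in> (\<Union>u\<in>?F. ?A u)" using t(1) by force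
  qed
  have fA: "finite (\<Union>u\<in>?F. ?A u)"
    by (rule finite_subset[of _ tup]) (auto intro: finite_PiE)
  have "card {t \<in> tup. clash D ?Z (Q t) t} \<le> card (\<Union>u\<in>?F. ?A u)"
    by (rule card_mono[OF fA sub])
  also have "\<dots> \<le> (\<Sum>u\<in>?F. card (?A u))"
    using fin\<P> by (intro card_UN_le) auto
  also have "\<dots> \<le> card ?F * (L - D) ^ n"
  proof (rule sum_bounded_above[where K = "(L - D) ^ n", simplified of_nat_id])
    show "card (?A u) \<le> (L - D) ^ n" if "u \<in> ?F" for u
      using that card_sat2_far[of D "fst u" "snd u"] by (simp add: case_prod_unfold)
  qed
  also have "\<dots> \<le> (R + q)\<^sup>2 * (L - D) ^ n"
    using c\<P> card_mono[OF fin\<P>, of ?F] by (intro mult_right_mono) auto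
  finally have "real (card {t \<in> tup. clash D ?Z (Q t) t}) \<le> real ((R + q)\<^sup>2 * (L - D) ^ n)"
    by (rule of_nat_mono)
  then have "real (card {t \<in> tup. clash D ?Z (Q t) t}) / real n ^ n \<le> real ((R + q)\<^sup>2) * real (L - D) ^ n / real n ^ n"
    by (intro divide_right_mono) auto
  then show ?thesis
    unfolding Q_def[symmetric]
    by (subst avg_of_bool) (auto simp: card_PiE power_divide intro: finite_PiE)
qed

lemma key_prob:
  assumes n: "n > 0" and i: "i < M" and C: "C \<subseteq> {..<n}"
  shows "avg KK (\<lambda>K. of_bool (fst (K i) \<in> C \<or> snd (K i) \<in> C)) \<le> 2 * real (card C) / real n"
proof (rule avg_resample_le[of i])
  fix K
  let ?k = "{k \<in> {..<n} \<times> {..<n}. fst k \<in> C \<or> snd k \<in> C}"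
  have "?k \<subseteq> C \<times> {..<n} \<union> {..<n} \<times> C" by auto
  moreover have "finite C" using C finite_subset by auto
  ultimately have "card ?k \<le> card (C \<times> {..<n} \<union> {..<n} \<times> C)" by (intro card_mono) auto
  also have "\<dots> \<le> card (C \<times> {..<n}) + card ({..<n} \<times> C)" by (rule card_Un_le)
  also have "\<dots> = 2 * card C * n" by (simp add: card_cartesian_product)
  finally have "card ?k \<le> 2 * card C * n" .
  then have "real (card ?k) \<le> real (2 * card C * n)" by (rule of_nat_mono)
  then have "real (card ?k) / (real n * real n) \<le> 2 * real (card C) / real n"
    using n by (simp add: field_simps)
  then show "avg ({..<n} \<times> {..<n}) (\<lambda>t. of_bool (fst ((K(i := t)) i) \<in> C \<or> snd ((K(i := t)) i) \<in> C))
      \<le> 2 * real (card C) / real n"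
    by (subst avg_of_bool) (simp_all add: card_cartesian_product)
qed (use n i in auto)

text \<open>A parity difference under term \<open>i\<close> needs a key in \<open>C i\<close>, the
  coordinates where some point of \<open>G i\<close> differs from the centre. The sets
  \<open>G i\<close> are disjoint, so the sizes of the \<open>C i\<close> add up to at most
  \<open>r * (2 * D + 4)\<close>, however many terms there are.\<close>

lemma conflict_prob:
  assumes n: "n > 0" and nc: "\<And>i. i < M \<Longrightarrow> \<not> clash D Z Q (T i)"
    and P: "finite Z" "finite Q" "card (Z \<union> Q) \<le> r"
  shows "avg KK (\<lambda>K. of_bool (conflict T K (Z \<union> Q))) \<le> 2 * real r * (2 * D + 4) / n"
proof -
  let ?P = "Z \<union> Q"
  define G where "G i = {x \<in> ?P. live x \<and> cov T x = {i}}" for i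
  have finG: "finite (G i)" for i using P by (auto simp: G_def)
  have G_sat: "sat (T i) x \<and> live x" if "x \<in> G i" for x i
  proof -
    have "i \<in> cov T x" "live x" using that by (auto simp: G_def)
    then show ?thesis by (auto simp: cov_def)
  qed
  have "\<exists>c. \<forall>x\<in>G i. card (diff n c x) \<le> 2 * D + 4" if i: "i < M" for i
  proof (cases "\<exists>z\<in>Z. live z \<and> sat (T i) z")
    case True
    then obtain z where z: "z \<in> Z" "live z" "sat (T i) z" by auto
    have "card (diff n z x) \<le> 2 * D + 4" if x: "x \<in> G i" for x
    proof (cases "x \<in> Z")
      case True
      then have "x = z" using nc[OF i] z G_sat[OF x] unfolding clash_def by blast
      then show ?thesis by (simp add: diff_def)
    next
      case False
      then have "x \<in> Q" using x by (auto simp: G_def)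
      then have "\<not> far D z x" using nc[OF i] z G_sat[OF x] unfolding clash_def by blast
      then show ?thesis using near_diff z G_sat[OF x] by blast
    qed
    then show ?thesis by blast
  next
    case False
    have "G i \<subseteq> Z \<union> Q" unfolding G_def by blast
    with False G_sat have GQ: "G i \<subseteq> Q" by blast
    have "card (diff n c x) \<le> 2 * D + 4" if "c \<in> G i" "x \<in> G i" for c x
      using near_diff[of c x D] nc[OF i] False GQ G_sat[OF that(1)] G_sat[OF that(2)] that
      unfolding clash_def by blast
    then show ?thesis by blast
  qed
  then have "\<forall>i. \<exists>c. i < M \<longrightarrow> (\<forall>x\<in>G i. card (diff n c x) \<le> 2 * D + 4)" by blast
  from choice[OF this] obtain c
    where c: "\<And>i x. i < M \<Longrightarrow> x \<in> G i \<Longrightarrow> card (diff n (c i) x) \<le> 2 * D + 4"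
    by blast
  define C where "C i = (\<Union>x\<in>G i. diff n (c i) x)" for i
  have C: "C i \<subseteq> {..<n}" for i by (auto simp: C_def diff_def)
  have cC: "card (C i) \<le> card (G i) * (2 * D + 4)" if "i < M" for i
    unfolding C_def using c[OF that] finG
    by (intro order_trans[OF card_UN_le] order_trans[OF sum_bounded_above[where K="2*D+4"]]) auto
  have "of_bool (conflict T K ?P) \<le> (\<Sum>i<M. of_bool (fst (K i) \<in> C i \<or> snd (K i) \<in> C i) :: real)"
    if K: "K \<in> KK" for K
  proof (cases "conflict T K ?P")
    case True
    then obtain i x y where i: "i < M" and xy: "x \<in> G i" "y \<in> G i" "parity K i x \<noteq> parity K i y"
      unfolding conflict_def G_def by blast
    have "fst (K i) < n" "snd (K i) < n" using K i by (auto simp: PiE_iff mem_Times_iff)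
    \<comment> \<open>If both keys avoided \<open>C i\<close>, then \<open>x\<close> and
      \<open>y\<close> would agree with the centre at both keys and have equal parity.\<close>
    then have "fst (K i) \<in> C i \<or> snd (K i) \<in> C i"
      using xy unfolding C_def diff_def parity_def by blast
    then have "(1::real) \<le> of_bool (fst (K i) \<in> C i \<or> snd (K i) \<in> C i)" by simp
    also have "\<dots> \<le> (\<Sum>i<M. of_bool (fst (K i) \<in> C i \<or> snd (K i) \<in> C i) :: real)"
      using i by (intro member_le_sum) auto
    finally show ?thesis by simp
  qed (auto intro: sum_nonneg)
  then have "avg KK (\<lambda>K. of_bool (conflict T K ?P)) \<le> avg KK (\<lambda>K. \<Sum>i<M. of_bool (fst (K i) \<in> C i \<or> snd (K i) \<in> C i))"
    by (rule avg_mono)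
  also have "\<dots> = (\<Sum>i<M. avg KK (\<lambda>K. of_bool (fst (K i) \<in> C i \<or> snd (K i) \<in> C i)))"
    by (rule avg_sum)
  also have "\<dots> \<le> (\<Sum>i<M. 2 * real (card (G i) * (2 * D + 4)) / n)"
  proof (rule sum_mono)
    fix i assume "i \<in> {..<M}"
    then have i: "i < M" by simp
    have "2 * real (card (C i)) / n \<le> 2 * real (card (G i) * (2 * D + 4)) / n"
      using of_nat_mono[OF cC[OF i]] by (intro divide_right_mono mult_left_mono) auto
    then show "avg KK (\<lambda>K. of_bool (fst (K i) \<in> C i \<or> snd (K i) \<in> C i)) \<le> 2 * real (card (G i) * (2 * D + 4)) / n"
      using key_prob[OF n i C[of i]] by linarith
  qed
  also have "\<dots> = 2 * real (\<Sum>i<M. card (G i)) * (2 * D + 4) / n"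
    by (simp add: sum_divide_distrib[symmetric] sum_distrib_left sum_distrib_right mult_ac)
  also have "(\<Sum>i<M. card (G i)) = card (\<Union>i<M. G i)"
    using finG by (intro card_UN_disjoint[symmetric]) (auto simp: G_def)
  also have "2 * real (card (\<Union>i<M. G i)) * (2 * D + 4) / n \<le> 2 * real r * (2 * D + 4) / n"
  proof -
    have "card (\<Union>i<M. G i) \<le> card ?P" using P by (intro card_mono) (auto simp: G_def)
    then have "real (card (\<Union>i<M. G i)) \<le> real r" using P by simp
    then show ?thesis by (intro divide_right_mono mult_right_mono mult_left_mono) auto
  qed
  finally show ?thesis by simp
qed

section \<open>Random candidates are pairwise far apart\<close>

definition upper :: "point set" where
  "upper = {x \<in> cube n. L \<le> weight n x}"

lemma finite_upper: "finite upper"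
  by (simp add: upper_def finite_cube)

text \<open>A point is determined by the set of its differences from \<open>x\<close>, and this set
  is small by \<open>near_diff\<close>.\<close>

lemma card_near:
  assumes "live x"
  shows "card {y \<in> upper. live y \<and> \<not> far D x y} \<le> (n + 1) ^ (2 * D + 4)"
proof -
  have "inj_on (diff n x) {y \<in> upper. live y \<and> \<not> far D x y}"
  proof (rule inj_onI)
    fix y y' assume y: "y \<in> {y \<in> upper. live y \<and> \<not> far D x y}" "y' \<in> {y \<in> upper. live y \<and> \<not> far D x y}"
      and eq: "diff n x y = diff n x y'"
    have "y j = y' j" if "j < n" for j
    proof -
      have "j \<in> diff n x y \<longleftrightarrow> j \<in> diff n x y'" using eq by simp
      then show ?thesis using that by (auto simp: diff_def)
    qed
    then show "y = y'"
      using y by (intro PiE_ext[of y "{..<n}" "\<lambda>_. UNIV" y']) (auto simp: upper_def cube_def)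
  qed
  moreover have "diff n x ` {y \<in> upper. live y \<and> \<not> far D x y} \<subseteq> {A. A \<subseteq> {..<n} \<and> card A \<le> 2 * D + 4}"
    using near_diff[OF assms] by (auto simp: diff_def)
  ultimately have "card {y \<in> upper. live y \<and> \<not> far D x y} \<le> card {A. A \<subseteq> {..<n} \<and> card A \<le> 2 * D + 4}"
    by (intro card_inj_on_le[of "diff n x"]) auto
  then show ?thesis using card_small_subsets order_trans by blast
qed

text \<open>A union bound over pairs, by induction: a new candidate must avoid the neighbourhoods of
  at most \<open>R\<close> earlier ones, and \<open>R\<^sup>2 + R\<close> is at most
  \<open>(Suc R)\<^sup>2\<close>.\<close>

lemma separated_prob:
  "avg (samples upper R) (\<lambda>zs. of_bool (\<not> separated D (set zs)))
     \<le> real (R\<^sup>2) * real ((n + 1) ^ (2 * D + 4)) / real (card upper)"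
proof (induction R)
  case 0
  show ?case by (simp add: avg_def separated_def)
next
  case (Suc R)
  let ?v = "real ((n + 1) ^ (2 * D + 4)) / real (card upper)"
  let ?near = "\<lambda>z y. live y \<and> live z \<and> \<not> far D y z"
  have pt: "of_bool (\<not> separated D (set (z # zs)))
      \<le> of_bool (\<not> separated D (set zs)) + (\<Sum>y\<in>set zs. of_bool (?near z y) :: real)" for z zs
  proof (cases "separated D (set zs) \<and> \<not> separated D (set (z # zs))")
    case True
    then obtain y where y: "y \<in> set zs" "?near z y"
      unfolding separated_def using far_commute by (auto; blast)
    have "(1::real) \<le> of_bool (?near z y)" using y by simp
    also have "\<dots> \<le> (\<Sum>y\<in>set zs. of_bool (?near z y))" using y(1) by (intro member_le_sum) auto
    finally show ?thesis using True by simp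
  next
    case False
    have "0 \<le> (\<Sum>y\<in>set zs. of_bool (?near z y) :: real)" by (intro sum_nonneg) auto
    then show ?thesis using False by auto
  qed
  have one: "avg upper (\<lambda>z. of_bool (?near z y)) \<le> ?v" for y
  proof (cases "live y")
    case True
    then show ?thesis
      using card_near[OF True, of D] by (simp add: avg_of_bool finite_upper divide_right_mono flip: of_nat_power of_nat_Suc)
  qed (simp add: avg_def)
  have "avg (samples upper (Suc R)) (\<lambda>zs. of_bool (\<not> separated D (set zs)))
      \<le> avg upper (\<lambda>z. avg (samples upper R) (\<lambda>zs. of_bool (\<not> separated D (set zs)) + (\<Sum>y\<in>set zs. of_bool (?near z y))))"
    unfolding avg_samples_Suc using pt by (intro avg_mono)
  also have "\<dots> = avg (samples upper R) (\<lambda>zs. avg upper (\<lambda>z. of_bool (\<not> separated D (set zs)))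
        + (\<Sum>y\<in>set zs. avg upper (\<lambda>z. of_bool (?near z y))))"
    by (subst avg_swap) (simp only: avg_add avg_sum)
  also have "\<dots> \<le> avg (samples upper R) (\<lambda>zs. of_bool (\<not> separated D (set zs)) + real R * ?v)"
  proof (intro avg_mono add_mono)
    fix zs assume zs: "zs \<in> samples upper R"
    show "avg upper (\<lambda>z. of_bool (\<not> separated D (set zs))) \<le> of_bool (\<not> separated D (set zs))"
      by (rule avg_le) auto
    have "(\<Sum>y\<in>set zs. avg upper (\<lambda>z. of_bool (?near z y))) \<le> real (card (set zs)) * ?v"
      using one by (intro sum_bounded_above) auto
    also have "\<dots> \<le> real R * ?v"
      using zs card_length[of zs] by (intro mult_right_mono) (auto simp: samples_def)
    finally show "(\<Sum>y\<in>set zs. avg upper (\<lambda>z. of_bool (?near z y))) \<le> real R * ?v" .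
  qed
  also have "\<dots> \<le> real (R\<^sup>2) * ?v + real R * ?v"
    unfolding avg_add
  proof (rule add_mono)
    show "avg (samples upper R) (\<lambda>zs. of_bool (\<not> separated D (set zs))) \<le> real (R\<^sup>2) * ?v"
      using Suc.IH by simp
  qed (rule avg_le, auto)
  also have "\<dots> \<le> real ((Suc R)\<^sup>2) * ?v"
  proof -
    have "real (R\<^sup>2) + real R \<le> real ((Suc R)\<^sup>2)" by (simp add: power2_eq_square algebra_simps)
    then have "(real (R\<^sup>2) + real R) * ?v \<le> real ((Suc R)\<^sup>2) * ?v" by (intro mult_right_mono) auto
    then show ?thesis by (simp only: distrib_right)
  qed
  finally show ?case by simp
qed

end

section \<open>Distance from monotonicity\<close>

lemma card_layer: "card {x \<in> cube n. weight n x = j} = n choose j"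
proof -
  have "bij_betw (\<lambda>x. {i. i < n \<and> x i}) {x \<in> cube n. weight n x = j} {A. A \<subseteq> {..<n} \<and> card A = j}"
  proof (rule bij_betwI[where g = "\<lambda>A. restrict (\<lambda>i. i \<in> A) {..<n}"])
    show "(\<lambda>x. {i. i < n \<and> x i}) \<in> {x \<in> cube n. weight n x = j} \<rightarrow> {A. A \<subseteq> {..<n} \<and> card A = j}"
      by (auto simp: weight_def)
  next
    have "{i. i < n \<and> restrict (\<lambda>i. i \<in> A) {..<n} i} = A" if "A \<subseteq> {..<n}" for A
      using that by auto
    then show "(\<lambda>A. restrict (\<lambda>i. i \<in> A) {..<n}) \<in> {A. A \<subseteq> {..<n} \<and> card A = j} \<rightarrow> {x \<in> cube n. weight n x = j}"
      unfolding weight_def by (auto simp: cube_def)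
  next
    fix x assume "x \<in> {x \<in> cube n. weight n x = j}"
    then show "restrict (\<lambda>i. i \<in> {i. i < n \<and> x i}) {..<n} = x"
      by (auto simp: cube_def PiE_iff extensional_def fun_eq_iff)
  next
    fix A assume "A \<in> {A. A \<subseteq> {..<n} \<and> card A = j}"
    then show "{i. i < n \<and> restrict (\<lambda>i. i \<in> A) {..<n} i} = A" by auto
  qed
  then have "card {x \<in> cube n. weight n x = j} = card {A. A \<subseteq> {..<n} \<and> card A = j}"
    by (rule bij_betw_same_card)
  also have "\<dots> = n choose j" using n_subsets[of "{..<n}" j] by simp
  finally show ?thesis .
qed

context talagrand
begin

section \<open>Satisfaction probabilities and the expected number of bases\<close>

lemma avg_sat: "avg tup (\<lambda>t. of_bool (sat t x)) = (weight n x / n) ^ n"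
proof -
  have "card {t \<in> tup. sat t x} = weight n x ^ n"
    using card_sat2[of x x] by (simp add: meet_def weight_def)
  then show ?thesis
    by (subst avg_of_bool) (auto simp: card_PiE power_divide intro: finite_PiE)
qed

lemma tup_fin: "n > 0 \<Longrightarrow> finite tup \<and> tup \<noteq> {}"
  by (auto intro: finite_PiE simp: PiE_eq_empty_iff)

lemma avg_sat1:
  assumes "n > 0" "i < M"
  shows "avg TT (\<lambda>T. of_bool (sat (T i) x)) = (weight n x / n) ^ n"
proof -
  have "avg TT (\<lambda>T. of_bool (sat (T i) x)) = avg TT (\<lambda>T. avg tup (\<lambda>t. of_bool (sat ((T(i := t)) i) x)))"
    using assms tup_fin by (intro avg_resample) auto
  also have "\<dots> = (weight n x / n) ^ n"
    using assms tup_fin by (simp add: avg_sat avg_const finite_PiE PiE_eq_empty_iff)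
  finally show ?thesis .
qed

text \<open>Independence of two terms: resampling \<open>T i\<close> leaves \<open>T j\<close>
  fixed.\<close>

lemma avg_sat2:
  assumes "n > 0" "i < M" "j < M" "i \<noteq> j"
  shows "avg TT (\<lambda>T. of_bool (sat (T i) x) * of_bool (sat (T j) y)) = (weight n x / n) ^ n * (weight n y / n) ^ n"
proof -
  have "avg TT (\<lambda>T. of_bool (sat (T i) x) * of_bool (sat (T j) y))
      = avg TT (\<lambda>T. avg tup (\<lambda>t. of_bool (sat ((T(i := t)) i) x) * of_bool (sat ((T(i := t)) j) y)))"
    using assms tup_fin by (intro avg_resample) auto
  also have "\<dots> = avg TT (\<lambda>T. (weight n x / n) ^ n * of_bool (sat (T j) y))"
    using assms by (intro avg_cong) (simp add: avg_mult_right avg_sat del: of_bool_conj)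
  also have "\<dots> = (weight n x / n) ^ n * (weight n y / n) ^ n"
    using assms by (simp add: avg_mult_left avg_sat1)
  finally show ?thesis .
qed

definition admissible :: "point \<Rightarrow> nat \<times> nat \<Rightarrow> bool" where
  "admissible x k \<longleftrightarrow> fst k \<noteq> snd k \<and> \<not> x (fst k) \<and> \<not> x (snd k)"

lemma avg_admissible:
  assumes n: "n > 0" and i: "i < M" and w: "weight n x = L"
  shows "avg KK (\<lambda>K. of_bool (admissible x (K i))) \<ge> real ((n - L) * (n - L - 1)) / (real n)\<^sup>2"
proof -
  let ?X = "{j. j < n \<and> \<not> x j}"
  have "?X = {..<n} - {j. j < n \<and> x j}" by auto
  then have X: "card ?X = n - L" using w by (simp add: card_Diff_subset weight_def subset_eq)
  have "card (?X \<times> ?X - (\<lambda>j. (j, j)) ` ?X) = card (?X \<times> ?X) - card ((\<lambda>j. (j, j)) ` ?X)"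
    by (intro card_Diff_subset) auto
  also have "card ((\<lambda>j. (j, j)) ` ?X) = card ?X" by (intro card_image) (auto simp: inj_on_def)
  finally have "card (?X \<times> ?X - (\<lambda>j. (j, j)) ` ?X) = (n - L) * (n - L - 1)"
    using diff_mult_distrib2[of "n - L" "n - L" 1] by (simp add: X card_cartesian_product)
  moreover have "card (?X \<times> ?X - (\<lambda>j. (j, j)) ` ?X) \<le> card {k \<in> {..<n} \<times> {..<n}. admissible x k}"
    by (intro card_mono) (auto simp: admissible_def)
  ultimately have le: "(n - L) * (n - L - 1) \<le> card {k \<in> {..<n} \<times> {..<n}. admissible x k}" by simp
  have "avg KK (\<lambda>K. of_bool (admissible x (K i)))
      = avg KK (\<lambda>K. avg ({..<n} \<times> {..<n}) (\<lambda>k. of_bool (admissible x ((K(i := k)) i))))"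
    using n i by (intro avg_resample) auto
  also have "\<dots> = avg ({..<n} \<times> {..<n}) (\<lambda>k. of_bool (admissible x k))"
  proof -
    have "finite KK" "KK \<noteq> {}" using n by (auto simp: finite_PiE PiE_eq_empty_iff)
    from avg_const[OF this] show ?thesis by (simp only: fun_upd_same)
  qed
  also have "\<dots> = card {k \<in> {..<n} \<times> {..<n}. admissible x k} / (real n)\<^sup>2"
    by (simp add: avg_of_bool card_cartesian_product power2_eq_square)
  finally show ?thesis using le by (simp add: divide_right_mono del: of_nat_mult)
qed

text \<open>A Bonferroni estimate. \<open>A i\<close> indicates that term \<open>i\<close> holds at
  \<open>x\<close> with an admissible key, \<open>B i j\<close> that term \<open>j\<close> holds at
  the top of the chain as well. The hypothesis on \<open>M\<close> bounds the expected number of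
  other terms at the top by 1/2, so at least half of the first-order sum survives.\<close>

lemma avg_bases:
  assumes n: "n > 0" and w: "x \<in> cube n" "weight n x = L"
    and M: "real M * (real (L + 2) / n) ^ n \<le> 1 / 2"
  shows "avg TT (\<lambda>T. avg KK (\<lambda>K. of_bool (x \<in> bases T K)))
     \<ge> real M * (L / n) ^ n * (real ((n - L) * (n - L - 1)) / (real n)\<^sup>2) / 2"
proof -
  define up where "up k = x(fst k := True, snd k := True)" for k :: "nat \<times> nat"
  define A where "A i T K = (of_bool (admissible x (K i)) * of_bool (sat (T i) x) :: real)"
    for i T and K :: "nat \<Rightarrow> nat \<times> nat"
  define B where "B i j T K = A i T K * of_bool (sat (T j) (up (K i)))" for i j T K
  define chain where "chain i T K \<longleftrightarrow> admissible x (K i) \<and> sat (T i) x \<and> cov T (up (K i)) = {i}" for i T K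
  have le_up: "x \<le> up k" for k by (auto simp: up_def le_fun_def)
  have wup: "weight n (up k) = L + 2" if "admissible x k" "k \<in> {..<n} \<times> {..<n}" for k
    using that w weight_upd[of "fst k" n x] weight_upd[of "snd k" n "x(fst k := True)"]
    by (auto simp: up_def admissible_def)
  have step: "A i T K - (\<Sum>j\<in>{..<M} - {i}. B i j T K) \<le> of_bool (chain i T K)" if i: "i < M" for i T K
  proof (cases "admissible x (K i) \<and> sat (T i) x \<and> \<not> chain i T K")
    case True
    then have "cov T (up (K i)) \<noteq> {i}" by (auto simp: chain_def)
    moreover have "i \<in> cov T (up (K i))" using True i sat_mono[OF _ le_up] by (auto simp: cov_def)
    ultimately obtain j where j: "j < M" "j \<noteq> i" "sat (T j) (up (K i))" unfolding cov_def by blast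
    then have "1 \<le> B i j T K" using True by (simp add: B_def A_def)
    also have "\<dots> \<le> (\<Sum>j\<in>{..<M} - {i}. B i j T K)"
      using j by (intro member_le_sum) (auto simp: B_def A_def)
    finally show ?thesis using True by (simp add: A_def)
  next
    case False
    have "0 \<le> (\<Sum>j\<in>{..<M} - {i}. B i j T K)" by (intro sum_nonneg) (auto simp: B_def A_def)
    then show ?thesis using False by (auto simp: A_def)
  qed
  \<comment> \<open>At most one term carries a chain from \<open>x\<close>: a second one would hold
    at the top of the first chain. Hence the sum of the \<open>chain\<close> indicators is at most
    1.\<close>
  have pt: "(\<Sum>i<M. A i T K - (\<Sum>j\<in>{..<M} - {i}. B i j T K)) \<le> of_bool (x \<in> bases T K)" for T K
  proof -
    have uniq: "i = j" if "chain i T K" "chain j T K" "j < M" for i j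
    proof -
      have "sat (T j) x" using that by (simp add: chain_def)
      then have "j \<in> cov T (up (K i))" using sat_mono[OF _ le_up] that by (simp add: cov_def)
      moreover have "cov T (up (K i)) = {i}" using that by (simp add: chain_def)
      ultimately show ?thesis by simp
    qed
    have "(\<Sum>i<M. A i T K - (\<Sum>j\<in>{..<M} - {i}. B i j T K)) \<le> (\<Sum>i<M. of_bool (chain i T K))"
      using step by (intro sum_mono) auto
    also have "\<dots> = real (card {i \<in> {..<M}. chain i T K})"
      by (simp add: Collect_conj_eq Int_commute lessThan_def)
    also have "\<dots> \<le> of_bool (x \<in> bases T K)"
    proof (cases "\<exists>i<M. chain i T K")
      case True
      then obtain i where i: "i < M" "chain i T K" by auto
      then have "{i \<in> {..<M}. chain i T K} = {i}" using uniq by auto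
      moreover have "x \<in> bases T K"
        using i w unfolding bases_def chain_def admissible_def up_def by blast
      ultimately show ?thesis by simp
    next
      case False
      then have "{i \<in> {..<M}. chain i T K} = {}" by auto
      then show ?thesis by (simp only: card.empty) simp
    qed
    finally show ?thesis .
  qed
  define p where "p = (L / n) ^ n"
  define r where "r = (real (L + 2) / n) ^ n"
  define \<kappa> where "\<kappa> i = avg KK (\<lambda>K. of_bool (admissible x (K i)))" for i
  have avgA: "avg TT (\<lambda>T. avg KK (A i T)) = \<kappa> i * p" if "i < M" for i
    unfolding A_def avg_swap[of TT KK] avg_mult_left avg_sat1[OF n that] avg_mult_right \<kappa>_def p_def w(2) ..
  \<comment> \<open>Fixing \<open>K\<close> first makes the top of the chain a fixed point, so that
    \<open>avg_sat2\<close> applies.\<close>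
  have avgB: "avg TT (\<lambda>T. avg KK (B i j T)) \<le> \<kappa> i * p * r" if "i < M" "j \<in> {..<M} - {i}" for i j
  proof -
    have "avg TT (\<lambda>T. avg KK (B i j T)) = avg KK (\<lambda>K. of_bool (admissible x (K i)) *
        avg TT (\<lambda>T. of_bool (sat (T i) x) * of_bool (sat (T j) (up (K i)))))"
      unfolding B_def A_def mult.assoc avg_swap[of TT KK] avg_mult_left ..
    also have "\<dots> \<le> avg KK (\<lambda>K. of_bool (admissible x (K i)) * (p * r))"
    proof (rule avg_mono)
      fix K assume "K \<in> KK"
      then have "K i \<in> {..<n} \<times> {..<n}" using that by (auto simp: PiE_iff)
      then show "of_bool (admissible x (K i)) * avg TT (\<lambda>T. of_bool (sat (T i) x) * of_bool (sat (T j) (up (K i))))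
          \<le> of_bool (admissible x (K i)) * (p * r)"
        using that w wup[of "K i"] n
        by (cases "admissible x (K i)") (simp_all add: avg_sat2 p_def r_def)
    qed
    also have "\<dots> = \<kappa> i * p * r" by (simp add: avg_mult_right \<kappa>_def)
    finally show ?thesis .
  qed
  have nonneg: "0 \<le> p" "0 \<le> r" "0 \<le> \<kappa> i" for i by (auto simp: p_def r_def \<kappa>_def intro: avg_nonneg)
  have "real M * p * (real ((n - L) * (n - L - 1)) / (real n)\<^sup>2) / 2
      = (\<Sum>i<M. (real ((n - L) * (n - L - 1)) / (real n)\<^sup>2) * p / 2)" by simp
  also have "\<dots> \<le> (\<Sum>i<M. \<kappa> i * p / 2)"
    using avg_admissible[OF n _ w(2)] nonneg unfolding \<kappa>_def
    by (intro sum_mono divide_right_mono mult_right_mono) auto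
  also have "\<dots> \<le> (\<Sum>i<M. \<kappa> i * p - (\<Sum>j\<in>{..<M} - {i}. \<kappa> i * p * r))"
  proof (rule sum_mono)
    fix i assume "i \<in> {..<M}"
    have "real (card ({..<M} - {i})) * r \<le> real M * r"
      using nonneg card_mono[of "{..<M}" "{..<M} - {i}"] by (intro mult_right_mono) auto
    then have "real (card ({..<M} - {i})) * r \<le> 1 / 2" using M by (simp add: r_def)
    then have "\<kappa> i * p * (real (card ({..<M} - {i})) * r) \<le> \<kappa> i * p * (1 / 2)"
      using nonneg by (intro mult_left_mono) auto
    then show "\<kappa> i * p / 2 \<le> \<kappa> i * p - (\<Sum>j\<in>{..<M} - {i}. \<kappa> i * p * r)"
      unfolding sum_constant by (simp add: mult_ac)
  qed
  also have "\<dots> \<le> (\<Sum>i<M. avg TT (\<lambda>T. avg KK (A i T)) - (\<Sum>j\<in>{..<M} - {i}. avg TT (\<lambda>T. avg KK (B i j T))))"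
    using avgA avgB by (intro sum_mono diff_mono) auto
  also have "\<dots> = avg TT (\<lambda>T. avg KK (\<lambda>K. \<Sum>i<M. A i T K - (\<Sum>j\<in>{..<M} - {i}. B i j T K)))"
    by (simp only: avg_sum avg_diff)
  also have "\<dots> \<le> avg TT (\<lambda>T. avg KK (\<lambda>K. of_bool (x \<in> bases T K)))"
    using pt by (intro avg_mono)
  finally show ?thesis by (simp add: p_def)
qed

text \<open>Reverse Markov inequality: the mean of \<open>card (bases T K)\<close> is at least
  \<open>2 * \<theta>\<close> times the layer size and its maximum is at most the layer size, so it
  reaches \<open>\<theta>\<close> times that size with probability at least
  \<open>\<theta>\<close>.\<close>

lemma many_bases:
  assumes n: "n > 0" and M: "real M * (real (L + 2) / n) ^ n \<le> 1 / 2"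
    and \<theta>: "2 * \<theta> \<le> real M * (L / n) ^ n * (real ((n - L) * (n - L - 1)) / (real n)\<^sup>2) / 2" "0 \<le> \<theta>"
  shows "avg TT (\<lambda>T. avg KK (\<lambda>K. of_bool (\<theta> * real (n choose L) \<le> real (card (bases T K))))) * real (n choose L)
     \<ge> \<theta> * real (n choose L)"
proof -
  let ?N = "real (n choose L)"
  let ?X = "{x \<in> cube n. weight n x = L}"
  have fX: "finite ?X" using finite_cube by auto
  have fin: "finite KK" "KK \<noteq> {}" "finite TT" "TT \<noteq> {}"
    using n tup_fin by (auto simp: finite_PiE PiE_eq_empty_iff)
  have sub: "bases T K \<subseteq> ?X" for T K by (auto simp: bases_def)
  have card_bases: "real (card (bases T K)) = (\<Sum>x\<in>?X. of_bool (x \<in> bases T K))" for T K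
    using fX sub[of T K] by (simp add: Int_absorb1)
  have "?N * (2 * \<theta>) \<le> (\<Sum>x\<in>?X. avg TT (\<lambda>T. avg KK (\<lambda>K. of_bool (x \<in> bases T K))))"
    using order_trans[OF \<theta>(1) avg_bases[OF n _ _ M]]
    by (subst card_layer[symmetric], intro sum_bounded_below) auto
  also have "\<dots> = avg TT (\<lambda>T. avg KK (\<lambda>K. real (card (bases T K))))"
    by (simp only: avg_sum card_bases)
  also have "\<dots> \<le> avg TT (\<lambda>T. avg KK (\<lambda>K. of_bool (\<theta> * ?N \<le> real (card (bases T K))) * ?N + \<theta> * ?N))"
  proof (intro avg_mono)
    fix T K
    have "card (bases T K) \<le> n choose L"
      using card_mono[OF fX sub] by (simp add: card_layer)
    then have "real (card (bases T K)) \<le> ?N" by simp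
    moreover have "0 \<le> \<theta> * ?N" using \<theta> by simp
    ultimately show "real (card (bases T K)) \<le> of_bool (\<theta> * ?N \<le> real (card (bases T K))) * ?N + \<theta> * ?N"
      by (cases "\<theta> * ?N \<le> real (card (bases T K))") auto
  qed
  also have "\<dots> = avg TT (\<lambda>T. avg KK (\<lambda>K. of_bool (\<theta> * ?N \<le> real (card (bases T K))))) * ?N + \<theta> * ?N"
    using avg_const[OF fin(1,2)] avg_const[OF fin(3,4)] by (simp only: avg_add) (simp only: avg_mult_right)
  finally show ?thesis by (simp add: algebra_simps)
qed

text \<open>The three summands are the three failures: two candidates are close, one of the
  \<open>M\<close> terms clashes, or a key lies among the exposed coordinates.\<close>

lemma conflict_total:
  assumes n: "n > 0" and S: "query_bound n S q"
  shows "avg TT (\<lambda>T. avg KK (\<lambda>K. avg BB (\<lambda>b. avg (samples upper R) (\<lambda>zs. of_bool (conflict T K (seen T b zs S))))))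
    \<le> real (R\<^sup>2) * real ((n + 1) ^ (2 * D + 4)) / real (card upper)
      + (real M * (real ((R + q)\<^sup>2) * (real (L - D) / n) ^ n) + 2 * real (R + q) * (2 * D + 4) / n)"
    (is "_ \<le> ?s + ?r")
proof -
  have r0: "0 \<le> ?r" by (intro add_nonneg_nonneg) auto
  have inner: "avg TT (\<lambda>T. avg KK (\<lambda>K. of_bool (conflict T K (seen T b zs S)))) \<le> ?r"
    if zs: "zs \<in> samples upper R" and sep: "separated D (set zs)" for zs b
  proof -
    have zs': "length zs = R" "set zs \<subseteq> cube n" using zs by (auto simp: samples_def upper_def)
    let ?Q = "\<lambda>T. queries T b zs S"
    have card_seen: "card (set zs \<union> ?Q T) \<le> R + q" for T
      using card_Un_le[of "set zs" "?Q T"] card_length[of zs] zs' asked_final[OF S zs'(2), of "yes T b"]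
        card_length[of "asked (final (yes T b) zs S)"] by linarith
    have "avg TT (\<lambda>T. avg KK (\<lambda>K. of_bool (conflict T K (seen T b zs S))))
        \<le> avg TT (\<lambda>T. (\<Sum>i<M. of_bool (clash D (set zs) (?Q T) (T i))) + 2 * real (R + q) * (2 * D + 4) / n)"
    proof (rule avg_mono)
      fix T
      show "avg KK (\<lambda>K. of_bool (conflict T K (seen T b zs S)))
          \<le> (\<Sum>i<M. of_bool (clash D (set zs) (?Q T) (T i))) + 2 * real (R + q) * (2 * D + 4) / n"
      proof (cases "\<exists>i<M. clash D (set zs) (?Q T) (T i)")
        case True
        then obtain i where i: "i < M" "clash D (set zs) (?Q T) (T i)" by auto
        have "avg KK (\<lambda>K. of_bool (conflict T K (seen T b zs S))) \<le> 1" by (rule avg_le) auto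
        also have "1 \<le> (of_bool (clash D (set zs) (?Q T) (T i)) :: real)" using i by simp
        also have "\<dots> \<le> (\<Sum>i<M. of_bool (clash D (set zs) (?Q T) (T i)))"
          using i by (intro member_le_sum) auto
        finally have "avg KK (\<lambda>K. of_bool (conflict T K (seen T b zs S))) \<le> (\<Sum>i<M. of_bool (clash D (set zs) (?Q T) (T i)))" .
        moreover have "0 \<le> 2 * real (R + q) * (2 * D + 4) / n" by simp
        ultimately show ?thesis by linarith
      next
        case False
        then have "avg KK (\<lambda>K. of_bool (conflict T K (seen T b zs S))) \<le> 2 * real (R + q) * (2 * D + 4) / n"
          unfolding seen_def using card_seen by (intro conflict_prob[OF n]) auto
        moreover have "0 \<le> (\<Sum>i<M. of_bool (clash D (set zs) (?Q T) (T i)) :: real)"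
          by (intro sum_nonneg) auto
        ultimately show ?thesis by linarith
      qed
    qed
    also have "\<dots> = (\<Sum>i<M. avg TT (\<lambda>T. of_bool (clash D (set zs) (?Q T) (T i)))) + 2 * real (R + q) * (2 * D + 4) / n"
      using tup_fin[OF n] by (simp only: avg_add avg_sum) (simp add: avg_const finite_PiE PiE_eq_empty_iff)
    also have "\<dots> \<le> (\<Sum>i<M. real ((R + q)\<^sup>2) * (real (L - D) / n) ^ n) + 2 * real (R + q) * (2 * D + 4) / n"
    proof (intro add_right_mono sum_mono)
      fix i assume "i \<in> {..<M}"
      then have i: "i < M" by simp
      show "avg TT (\<lambda>T. of_bool (clash D (set zs) (?Q T) (T i))) \<le> real ((R + q)\<^sup>2) * (real (L - D) / n) ^ n"
      proof (rule avg_resample_le[of i])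
        show "avg tup (\<lambda>t. of_bool (clash D (set zs) (?Q (T(i := t))) ((T(i := t)) i)))
            \<le> real ((R + q)\<^sup>2) * (real (L - D) / n) ^ n" for T
          unfolding fun_upd_same by (rule clash_prob[OF sep zs' S i])
      qed (use i tup_fin[OF n] in auto)
    qed
    finally show ?thesis by simp
  qed
  \<comment> \<open>Candidates and bits are averaged last, so that terms and keys are random for a
    fixed list and fixed bits, as \<open>inner\<close> requires.\<close>
  have "avg TT (\<lambda>T. avg KK (\<lambda>K. avg BB (\<lambda>b. avg (samples upper R) (\<lambda>zs. of_bool (conflict T K (seen T b zs S))))))
      = avg (samples upper R) (\<lambda>zs. avg BB (\<lambda>b. avg TT (\<lambda>T. avg KK (\<lambda>K. of_bool (conflict T K (seen T b zs S))))))"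
    by (simp only: avg_swap[of BB "samples upper R"] avg_swap[of KK "samples upper R"]
        avg_swap[of TT "samples upper R"] avg_swap[of KK BB] avg_swap[of TT BB])
  also have "\<dots> \<le> avg (samples upper R) (\<lambda>zs. of_bool (\<not> separated D (set zs)) + ?r)"
  proof (rule avg_mono, rule avg_le)
    fix zs b assume zs: "zs \<in> samples upper R"
    show "avg TT (\<lambda>T. avg KK (\<lambda>K. of_bool (conflict T K (seen T b zs S)))) \<le> of_bool (\<not> separated D (set zs)) + ?r"
    proof (cases "separated D (set zs)")
      case True
      then show ?thesis using inner[OF zs True] by simp
    next
      case False
      have "avg TT (\<lambda>T. avg KK (\<lambda>K. of_bool (conflict T K (seen T b zs S)))) \<le> 1"
        by (intro avg_le) auto
      moreover have "of_bool (\<not> separated D (set zs)) = (1 :: real)" using False by simp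
      ultimately show ?thesis using r0 by linarith
    qed
  qed (use r0 in auto)
  also have "\<dots> \<le> ?s + ?r"
    by (subst avg_add, rule add_mono[OF separated_prob], rule avg_le[OF _ r0]) simp
  finally show ?thesis .
qed

end

section \<open>The advantage of a tester\<close>

lemma integrable_avg:
  "(\<And>a. a \<in> A \<Longrightarrow> integrable M (f a)) \<Longrightarrow> integrable M (\<lambda>x. avg A (\<lambda>a. f a x))"
  by (simp add: avg_def)

lemma integral_avg:
  "(\<And>a. a \<in> A \<Longrightarrow> integrable M (f a)) \<Longrightarrow> (\<integral>x. avg A (\<lambda>a. f a x) \<partial>M) = avg A (\<lambda>a. \<integral>x. f a x \<partial>M)"
  by (simp add: avg_def)

context talagrand
begin

text \<open>The layer \<open>L + 3\<close> is full whatever the terms and values are. This bounds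
  the success rate of rejection sampling from \<open>upper\<close> and puts all the random functions
  into one size class.\<close>

lemma ones_fn:
  shows "ones n (fn T v) \<subseteq> upper" and "n choose (L + 3) \<le> card (ones n (fn T v))"
proof -
  show "ones n (fn T v) \<subseteq> upper" by (auto simp: ones_def upper_def fn_def)
  have "card {x \<in> cube n. weight n x = L + 3} \<le> card (ones n (fn T v))"
    by (intro card_mono) (auto simp: ones_def fn_def finite_cube)
  then show "n choose (L + 3) \<le> card (ones n (fn T v))" by (simp add: card_layer)
qed

text \<open>The coupling is applied for each candidate list. The simulation error enters only on the
  \<open>yes\<close> side, because on the \<open>no\<close> side simulated acceptance never exceeds
  the true one.\<close>

lemma advantage_le:
  fixes \<rho> :: real
  assumes S: "query_bound n S q"
    and \<rho>: "0 < \<rho>" "\<rho> * card upper \<le> n choose (L + 3)" "0 < n choose (L + 3)"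
  shows "avg BB (\<lambda>b. accept_prob n (yes T b) S - accept_prob n (no T K b) S)
    \<le> 2 ^ q * (1 - \<rho> / 2) ^ R + avg BB (\<lambda>b. avg (samples upper R) (\<lambda>zs. of_bool (conflict T K (seen T b zs S))))"
proof -
  let ?Z = "samples upper R"
  have sim: "accept_prob n (fn T v) S - 2 ^ q * (1 - \<rho> / 2) ^ R \<le> sim_prob (fn T v) upper R S
      \<and> sim_prob (fn T v) upper R S \<le> accept_prob n (fn T v) S" for v
  proof (rule simulation)
    show "upper \<subseteq> cube n" by (auto simp: upper_def)
    show "\<rho> * card upper \<le> card (ones n (fn T v))"
      using \<rho>(2) ones_fn(2)[of T v] by linarith
    show "ones n (fn T v) \<noteq> {}" using \<rho>(3) ones_fn(2)[of T v] by (metis card.empty not_less)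
  qed (use ones_fn(1) \<rho> S in auto)
  have fB: "finite BB" "BB \<noteq> {}" by auto
  have pt: "avg BB (\<lambda>b. of_bool (verdict (yes T b) (final (yes T b) zs S)))
      \<le> avg BB (\<lambda>b. of_bool (verdict (no T K b) (final (no T K b) zs S)))
        + avg BB (\<lambda>b. of_bool (conflict T K (seen T b zs S)))" for zs
    unfolding avg_of_bool[OF fB(1)] add_divide_distrib[symmetric]
    using of_nat_mono[OF coupling, where 'a = real] by (intro divide_right_mono) auto
  have "avg BB (\<lambda>b. sim_prob (yes T b) upper R S)
      = avg ?Z (\<lambda>zs. avg BB (\<lambda>b. of_bool (verdict (yes T b) (final (yes T b) zs S))))"
    unfolding sim_prob_def by (rule avg_swap)
  also have "\<dots> \<le> avg ?Z (\<lambda>zs. avg BB (\<lambda>b. of_bool (verdict (no T K b) (final (no T K b) zs S)))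
        + avg BB (\<lambda>b. of_bool (conflict T K (seen T b zs S))))"
    using pt by (intro avg_mono)
  also have "\<dots> = avg BB (\<lambda>b. sim_prob (no T K b) upper R S)
      + avg BB (\<lambda>b. avg ?Z (\<lambda>zs. of_bool (conflict T K (seen T b zs S))))"
    unfolding avg_add sim_prob_def by (simp only: avg_swap[of ?Z BB])
  finally have mid: "avg BB (\<lambda>b. sim_prob (yes T b) upper R S) \<le> \<dots>" .
  have "avg BB (\<lambda>b. accept_prob n (yes T b) S - accept_prob n (no T K b) S)
      \<le> avg BB (\<lambda>b. (sim_prob (yes T b) upper R S + 2 ^ q * (1 - \<rho> / 2) ^ R) - sim_prob (no T K b) upper R S)"
    unfolding yes_def no_def
  proof (intro avg_mono diff_mono)
    show "accept_prob n (fn T (\<lambda>i x. i \<in> b)) S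
        \<le> sim_prob (fn T (\<lambda>i x. i \<in> b)) upper R S + 2 ^ q * (1 - \<rho> / 2) ^ R" for b
      using sim[of "\<lambda>i x. i \<in> b"] by linarith
    show "sim_prob (fn T (\<lambda>i x. (i \<in> b) \<noteq> parity K i x)) upper R S
        \<le> accept_prob n (fn T (\<lambda>i x. (i \<in> b) \<noteq> parity K i x)) S" for b
      using sim by blast
  qed
  also have "\<dots> = avg BB (\<lambda>b. sim_prob (yes T b) upper R S) + 2 ^ q * (1 - \<rho> / 2) ^ R
      - avg BB (\<lambda>b. sim_prob (no T K b) upper R S)"
    by (simp only: avg_diff avg_add avg_const[OF fB])
  finally show ?thesis using mid by linarith
qed

text \<open>Yao's averaging argument: a correct tester separates the cases by 1/3 on every good
  pair, while every deterministic strategy in its support has a small advantage on average.\<close>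

lemma tester_advantage:
  fixes \<rho> \<epsilon> \<beta> :: real
  assumes A: "nonadaptive_tester n F \<epsilon> q A"
    and \<rho>: "0 < \<rho>" "\<rho> * card upper \<le> n choose (L + 3)" "0 < n choose (L + 3)"
    and F: "\<And>T v. fn T v \<in> F"
    and far: "\<And>T K b. K \<in> KK \<Longrightarrow> good T K \<Longrightarrow> \<epsilon> \<le> rel_dist_mono n (no T K b)"
    and conflict: "\<And>S. query_bound n S q \<Longrightarrow>
      avg TT (\<lambda>T. avg KK (\<lambda>K. avg BB (\<lambda>b. avg (samples upper R) (\<lambda>zs. of_bool (conflict T K (seen T b zs S)))))) \<le> \<beta>"
  shows "avg TT (\<lambda>T. avg KK (\<lambda>K. of_bool (good T K))) * (1 / 3 - 2 ^ q * (1 - \<rho> / 2) ^ R) \<le> \<beta>"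
proof -
  define acc where "acc f = pmf (bind_pmf A (run n f)) True" for f
  let ?a = "\<lambda>f S. accept_prob n f S"
  let ?d = "2 ^ q * (1 - \<rho> / 2) ^ R"
  let ?c = "\<lambda>S T K b. avg (samples upper R) (\<lambda>zs. of_bool (conflict T K (seen T b zs S)))"
  have acc: "acc f = (\<integral>S. ?a f S \<partial>measure_pmf A)" for f
    unfolding acc_def by (rule pmf_bind)
  have int: "integrable (measure_pmf A) (?a f)" for f
    by (rule measure_pmf.integrable_const_bound[where B = 1]) (auto simp: pmf_le_1)
  have qb: "query_bound n S q" if "S \<in> set_pmf A" for S
    using A that by (auto simp: nonadaptive_tester_def)
  have adv: "1 / 3 \<le> acc (yes T b) - acc (no T K b)" if "K \<in> KK" "good T K" for T K b
  proof -
    have "2 / 3 \<le> acc (yes T b)"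
      using A F mono_yes unfolding nonadaptive_tester_def acc_def yes_def by blast
    moreover have "2 / 3 \<le> pmf (bind_pmf A (run n (no T K b))) False"
      using A F far[OF that] unfolding nonadaptive_tester_def no_def by blast
    moreover have "pmf (bind_pmf A (run n (no T K b))) False = 1 - acc (no T K b)"
      using pmf_False_conv_True unfolding acc_def by blast
    ultimately show ?thesis by linarith
  qed
  \<comment> \<open>The factor \<open>of_bool (good T K)\<close> removes the pairs for which
    \<open>no\<close> may be close to monotone, where the tester promises nothing.\<close>
  define W where "W S = avg TT (\<lambda>T. avg KK (\<lambda>K. of_bool (good T K) * avg BB (\<lambda>b. ?a (yes T b) S - ?a (no T K b) S)))"
    for S
  have intW: "integrable (measure_pmf A) W"
    unfolding W_def by (intro integrable_avg integrable_mult_right Bochner_Integration.integrable_diff int)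
  have "avg TT (\<lambda>T. avg KK (\<lambda>K. of_bool (good T K))) * (1 / 3)
      = avg TT (\<lambda>T. avg KK (\<lambda>K. of_bool (good T K) * (1 / 3)))"
    by (simp only: avg_mult_right)
  also have "\<dots> \<le> avg TT (\<lambda>T. avg KK (\<lambda>K. of_bool (good T K) * avg BB (\<lambda>b. acc (yes T b) - acc (no T K b))))"
  proof (intro avg_mono)
    fix T K assume K: "K \<in> KK"
    have "1 / 3 \<le> avg BB (\<lambda>b. acc (yes T b) - acc (no T K b))" if "good T K"
    proof -
      have "avg BB (\<lambda>_. 1 / 3) \<le> avg BB (\<lambda>b. acc (yes T b) - acc (no T K b))"
        using adv[OF K that] by (rule avg_mono)
      then show ?thesis by (subst (asm) avg_const) auto
    qed
    then show "of_bool (good T K) * (1 / 3) \<le> of_bool (good T K) * avg BB (\<lambda>b. acc (yes T b) - acc (no T K b))"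
      by (cases "good T K") auto
  qed
  also have "\<dots> = (\<integral>S. W S \<partial>measure_pmf A)"
    unfolding W_def acc
    by (simp only: integral_avg integrable_avg integrable_mult_right Bochner_Integration.integrable_diff
        Bochner_Integration.integral_diff integral_mult_right_zero int)
  also have "\<dots> \<le> avg TT (\<lambda>T. avg KK (\<lambda>K. of_bool (good T K))) * ?d + \<beta>"
  proof (rule measure_pmf.integral_le_const[OF intW], rule AE_pmfI)
    fix S assume S: "S \<in> set_pmf A"
    have "W S \<le> avg TT (\<lambda>T. avg KK (\<lambda>K. of_bool (good T K) * ?d + avg BB (?c S T K)))"
      unfolding W_def
    proof (intro avg_mono)
      fix T K
      \<comment> \<open>The conflict term is nonnegative, so it can be kept at pairs that are not
        good, where the left side vanishes.\<close>
      have "0 \<le> avg BB (?c S T K)" by (intro avg_nonneg) auto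
      then show "of_bool (good T K) * avg BB (\<lambda>b. ?a (yes T b) S - ?a (no T K b) S)
          \<le> of_bool (good T K) * ?d + avg BB (?c S T K)"
        using advantage_le[OF qb[OF S] \<rho>, of T K R] by (cases "good T K") auto
    qed
    also have "\<dots> \<le> avg TT (\<lambda>T. avg KK (\<lambda>K. of_bool (good T K))) * ?d + \<beta>"
      using conflict[OF qb[OF S]] by (simp only: avg_add avg_mult_right)
    finally show "W S \<le> avg TT (\<lambda>T. avg KK (\<lambda>K. of_bool (good T K))) * ?d + \<beta>" .
  qed
  finally show ?thesis by (simp only: right_diff_distrib)
qed

lemma rel_dist_no_ge:
  fixes \<epsilon> :: real
  assumes K: "K \<in> KK" and c: "0 < card (ones n (no T K b))"
    and le: "\<epsilon> * card (ones n (no T K b)) \<le> card (bases T K)"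
  shows "\<epsilon> \<le> rel_dist_mono n (no T K b)"
proof -
  have "\<epsilon> \<le> rel_dist n (no T K b) g" if g: "mono_on (cube n) g" for g
  proof -
    have "\<epsilon> * card (ones n (no T K b)) \<le> card (sym_diff (ones n (no T K b)) (ones n g))"
      using le card_bases_le[OF K g, of T b] by linarith
    then show ?thesis using c by (simp add: rel_dist_def pos_le_divide_eq)
  qed
  then show ?thesis
    unfolding rel_dist_mono_def
    by (subst Min_ge_iff) (auto simp: finite_rel_dist_values intro: exI[of _ "\<lambda>_. False"] mono_onI)
qed

end

section \<open>Ratios of consecutive binomial coefficients\<close>

lemma binomial_step: "Suc k * (n choose Suc k) = (n - k) * (n choose k)"
  by (metis binomial_absorb_comp binomial_absorption)

lemma choose_upper_half:
  "real (4 * m choose (3 * m + d)) \<le> real (4 * m choose (3 * m)) * (1 / 2) ^ d"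
proof (induction d)
  case (Suc d)
  let ?c = "\<lambda>k. real (4 * m choose k)"
  have "real (Suc (3 * m + d)) * ?c (Suc (3 * m + d)) = real (4 * m - (3 * m + d)) * ?c (3 * m + d)"
    by (simp only: binomial_step flip: of_nat_mult)
  also have "\<dots> \<le> (real (Suc (3 * m + d)) / 2) * ?c (3 * m + d)"
    by (intro mult_right_mono) auto
  finally have "real (Suc (3 * m + d)) * ?c (Suc (3 * m + d)) \<le> real (Suc (3 * m + d)) * (?c (3 * m + d) / 2)"
    by simp
  then have "?c (Suc (3 * m + d)) \<le> ?c (3 * m + d) / 2"
    by (subst (asm) mult_le_cancel_left_pos) auto
  then show ?case using Suc.IH by simp
qed simp

text \<open>The ratio is \<open>(m - d) / (3 * m + d + 1)\<close>, at least 1/4 exactly when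
  \<open>m \<ge> 5 * d + 1\<close>; for \<open>d = 2\<close> this is the bound 11.\<close>

lemma choose_upper_quarter:
  assumes "d \<le> 2" "11 \<le> m"
  shows "real (4 * m choose (3 * m + d)) / 4 \<le> real (4 * m choose (3 * m + Suc d))"
proof -
  let ?c = "\<lambda>k. real (4 * m choose k)"
  have "(real (Suc (3 * m + d)) / 4) * ?c (3 * m + d) \<le> real (4 * m - (3 * m + d)) * ?c (3 * m + d)"
    using assms by (intro mult_right_mono) auto
  also have "\<dots> = real (Suc (3 * m + d)) * ?c (Suc (3 * m + d))"
    by (simp only: binomial_step flip: of_nat_mult)
  finally have "real (Suc (3 * m + d)) * (?c (3 * m + d) / 4) \<le> real (Suc (3 * m + d)) * ?c (Suc (3 * m + d))"
    by simp
  then have "?c (3 * m + d) / 4 \<le> ?c (Suc (3 * m + d))"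
    by (subst (asm) mult_le_cancel_left_pos) auto
  then show ?thesis by simp
qed

section \<open>Parameters\<close>

text \<open>By \<open>choose_upper_half\<close> the layers from \<open>3 * m\<close> upwards are
  dominated by a geometric series of ratio 1/2.\<close>

lemma card_upper_le: "card (talagrand.upper (4 * m) (3 * m)) \<le> 2 * (4 * m choose (3 * m))"
proof -
  let ?X = "\<lambda>d. {x \<in> cube (4 * m). weight (4 * m) x = 3 * m + d}"
  have le: "weight (4 * m) x \<le> 4 * m" for x
    unfolding weight_def using card_mono[of "{..<4 * m}" "{j. j < 4 * m \<and> x j}"] by auto
  have "talagrand.upper (4 * m) (3 * m) \<subseteq> (\<Union>d\<le>m. ?X d)"
  proof
    fix x assume "x \<in> talagrand.upper (4 * m) (3 * m)"
    then have "x \<in> ?X (weight (4 * m) x - 3 * m)" "weight (4 * m) x - 3 * m \<le> m"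
      using le[of x] by (auto simp: talagrand.upper_def)
    then show "x \<in> (\<Union>d\<le>m. ?X d)" by blast
  qed
  then have "card (talagrand.upper (4 * m) (3 * m)) \<le> card (\<Union>d\<le>m. ?X d)"
    by (intro card_mono) (auto simp: finite_cube)
  also have "\<dots> \<le> (\<Sum>d\<le>m. card (?X d))" by (intro card_UN_le) auto
  finally have "real (card (talagrand.upper (4 * m) (3 * m))) \<le> (\<Sum>d\<le>m. real (4 * m choose (3 * m + d)))"
    unfolding card_layer by (simp flip: of_nat_sum)
  also have "\<dots> \<le> (\<Sum>d\<le>m. real (4 * m choose (3 * m)) * (1 / 2) ^ d)"
    by (intro sum_mono choose_upper_half)
  also have "\<dots> = real (4 * m choose (3 * m)) * (\<Sum>d\<le>m. (1 / 2) ^ d)"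
    by (simp add: sum_distrib_left)
  also have "(\<Sum>d\<le>k. (1 / 2 :: real) ^ d) = 2 - (1 / 2) ^ k" for k :: nat
    by (induction k) auto
  also have "real (4 * m choose (3 * m)) * (2 - (1 / 2) ^ m) \<le> real (4 * m choose (3 * m)) * 2"
    by (intro mult_left_mono) auto
  finally show ?thesis by linarith
qed

lemma choose_shift3_ge:
  assumes "11 \<le> m"
  shows "real (4 * m choose (3 * m)) / 64 \<le> real (4 * m choose (3 * m + 3))"
  using choose_upper_quarter[of 0 m] choose_upper_quarter[of 1 m] choose_upper_quarter[of 2 m] assms
  by (simp add: eval_nat_numeral)

lemma power4_le_choose: "4 ^ m \<le> 4 * m choose (3 * m)"
proof (cases "m = 0")
  case False
  have "(real (4 * m) / real m) ^ m \<le> real (4 * m choose m)"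
    by (rule binomial_ge_n_over_k_pow_k) auto
  then have "real (4 ^ m) \<le> real (4 * m choose m)" using False by simp
  also have "4 * m choose m = 4 * m choose (3 * m)"
    by (subst binomial_symmetric) auto
  finally show ?thesis by linarith
qed simp

text \<open>Only \<open>D\<close> is left free: a larger \<open>D\<close> makes clashes rarer in the
  second summand but enlarges the neighbourhoods in the first and third. The distance 1/32768 is
  half of \<open>\<theta>\<close>, as a good pair has at least \<open>\<theta> * N\<close> bases and
  \<open>no\<close> has at most \<open>2 * N\<close> ones.\<close>

lemma query_inequality:
  fixes m q D R :: nat
  defines "N \<equiv> real (4 * m choose (3 * m))"
  defines "F \<equiv> {f. 1 / 64 * N \<le> real (card (ones (4 * m) f)) \<and> real (card (ones (4 * m) f)) \<le> 2 * N}"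
  assumes m: "11 \<le> m" and R: "R = 256 * (q + 8)"
    and A: "nonadaptive_tester (4 * m) F (1 / 32768) q A"
  shows "1 / 50000 \<le> (real R)\<^sup>2 * (4 * real m + 1) ^ (2 * D + 4) / 4 ^ m
      + (real R + real q)\<^sup>2 * exp (- (4 / 3 * real D)) + 2 * (real R + real q) * (2 * real D + 4) / (4 * real m)"
proof -
  define n where "n = 4 * m"
  define L where "L = 3 * m"
  \<comment> \<open>On average about 1/64 of a term holds at weight \<open>L\<close>. Two layers
    higher this grows by a factor of at most \<open>exp (8 / 3)\<close>, hence at most 27, and 27/64
    is below 1/2.\<close>
  define M where "M = nat \<lfloor>(4 / 3 :: real) ^ n / 64\<rfloor>"
  interpret talagrand n L M .
  have n0: "n > 0" using m by (simp add: n_def)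
  have N_eq: "N = real (n choose L)" by (simp add: N_def n_def L_def)
  have N4: "4 ^ m \<le> N" using of_nat_mono[OF power4_le_choose[of m], where 'a = real] by (simp add: N_def)
  have N0: "0 < N" by (rule less_le_trans[OF _ N4]) simp
  have up: "real (card upper) \<le> 2 * N"
    using of_nat_mono[OF card_upper_le[of m], where 'a = real] by (simp add: N_def n_def L_def)
  have low: "N / 64 \<le> real (n choose (L + 3))"
    using choose_shift3_ge[OF m] by (simp add: N_def n_def L_def)
  have upN: "N \<le> real (card upper)"
    unfolding N_eq card_layer[symmetric] by (intro of_nat_mono card_mono) (auto simp: finite_cube upper_def)
  have F: "fn T v \<in> F" for T v
  proof -
    have "card (ones n (fn T v)) \<le> card upper" by (intro card_mono finite_upper ones_fn)
    then have "real (card (ones n (fn T v))) \<le> 2 * N" using up by linarith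
    moreover have "N / 64 \<le> real (card (ones n (fn T v)))"
      using low of_nat_mono[OF ones_fn(2)[of T v], where 'a = real] by linarith
    ultimately show ?thesis by (simp add: F_def n_def)
  qed
  have "0 \<le> (4 / 3 :: real) ^ n" by simp
  then have M_le: "real M \<le> (4 / 3) ^ n / 64" unfolding M_def by linarith
  \<comment> \<open>The floor loses at most a factor 2 once \<open>(4 / 3) ^ n\<close> reaches 128;
    here \<open>(4 / 3) ^ 4\<close> is more than 3.\<close>
  have "(3::real) ^ 5 \<le> 3 ^ m" using m by (intro power_increasing) auto
  also have "\<dots> \<le> ((4 / 3) ^ 4) ^ m" by (intro power_mono) (auto simp: eval_nat_numeral)
  finally have "243 \<le> (4 / 3 :: real) ^ n" by (simp add: n_def power_mult)
  then have M_ge: "(4 / 3) ^ n / 128 \<le> real M" unfolding M_def by linarith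
  have inv: "(4 / 3 :: real) ^ n * (3 / 4) ^ n = 1"
    by (simp flip: power_mult_distrib)
  have M_half: "real M * (real (L + 2) / n) ^ n \<le> 1 / 2"
  proof -
    have "real (L + 2) / n = 3 / 4 * (1 + 8 / 3 / n)"
      using n0 by (simp add: n_def L_def field_simps)
    then have "(real (L + 2) / n) ^ n = (3 / 4) ^ n * (1 + 8 / 3 / n) ^ n"
      by (simp only: power_mult_distrib)
    also have "\<dots> \<le> (3 / 4) ^ n * exp (8 / 3)"
      using n0 by (intro mult_left_mono exp_ge_one_plus_x_over_n_power_n) auto
    also have "exp (8 / 3 :: real) \<le> exp 1 ^ 3" by (simp flip: exp_of_nat_mult)
    also have "exp 1 ^ 3 \<le> (3 :: real) ^ 3" by (intro power_mono exp_le) auto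
    finally have "(real (L + 2) / n) ^ n \<le> (3 / 4) ^ n * 27" by simp
    then have "real M * (real (L + 2) / n) ^ n \<le> (4 / 3) ^ n / 64 * ((3 / 4) ^ n * 27)"
      using M_le by (intro mult_mono) auto
    also have "\<dots> = (4 / 3 :: real) ^ n * (3 / 4) ^ n * (27 / 64)" by simp
    also have "\<dots> \<le> 1 / 2" unfolding inv by simp
    finally show ?thesis .
  qed
  \<comment> \<open>\<open>2 * \<theta>\<close> is half of 1/128 (mean number of terms holding at
    weight \<open>L\<close>) times 1/32 (admissible keys).\<close>
  define \<theta> :: real where "\<theta> = 1 / 16384"
  define good where "good T K \<longleftrightarrow> \<theta> * real (n choose L) \<le> real (card (bases T K))" for T K
  have frac: "\<theta> \<le> avg TT (\<lambda>T. avg KK (\<lambda>K. of_bool (good T K)))"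
  proof -
    have Ln: "real L / real n = 3 / 4" using m by (simp add: L_def n_def)
    have "1 / 128 = (4 / 3 :: real) ^ n * (3 / 4) ^ n / 128" unfolding inv by simp
    also have "\<dots> \<le> real M * (L / n) ^ n"
      unfolding Ln using mult_right_mono[OF M_ge, of "(3 / 4) ^ n"] by simp
    finally have 1: "1 / 128 \<le> real M * (L / n) ^ n" .
    have nL: "real ((n - L) * (n - L - 1)) = real m * (real m - 1)"
      using m by (simp add: n_def L_def of_nat_diff)
    have 2: "1 / 32 \<le> real ((n - L) * (n - L - 1)) / (real n)\<^sup>2"
      unfolding nL using m by (simp add: n_def power2_eq_square field_simps)
    have 3: "(1 / 128) * (1 / 32) \<le> real M * (L / n) ^ n * (real ((n - L) * (n - L - 1)) / (real n)\<^sup>2)"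
      by (rule mult_mono[OF 1 2]) auto
    have "2 * \<theta> \<le> real M * (L / n) ^ n * (real ((n - L) * (n - L - 1)) / (real n)\<^sup>2) / 2"
      by (rule order_trans[OF _ divide_right_mono[OF 3]]) (simp_all add: \<theta>_def)
    from many_bases[OF n0 M_half this] show ?thesis
      using N0 unfolding good_def N_eq by (simp add: \<theta>_def)
  qed
  have far: "1 / 32768 \<le> rel_dist_mono n (no T K b)" if "K \<in> KK" "good T K" for T K b
  proof (rule rel_dist_no_ge[OF that(1)])
    have "no T K b \<in> F" unfolding no_def by (rule F)
    then have "N / 64 \<le> card (ones n (no T K b))" "card (ones n (no T K b)) \<le> 2 * N"
      by (auto simp: F_def n_def)
    then show "0 < card (ones n (no T K b))" "1 / 32768 * card (ones n (no T K b)) \<le> card (bases T K)"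
      using N0 that(2) unfolding good_def \<theta>_def N_eq by linarith+
  qed
  have "0 < real (n choose (L + 3))" using low N0 by linarith
  then have low0: "0 < n choose (L + 3)" by simp
  \<comment> \<open>The success rate is at least \<open>(N / 64) / (2 * N)\<close>.\<close>
  have \<rho>: "(1 / 128) * real (card upper) \<le> real (n choose (L + 3))" using up low by linarith
  have "avg TT (\<lambda>T. avg KK (\<lambda>K. of_bool (good T K))) * (1 / 3 - 2 ^ q * (1 - 1 / 128 / 2) ^ R)
      \<le> real (R\<^sup>2) * real ((n + 1) ^ (2 * D + 4)) / real (card upper)
      + (real M * (real ((R + q)\<^sup>2) * (real (L - D) / n) ^ n) + 2 * real (R + q) * (2 * D + 4) / n)"
    by (rule tester_advantage[OF A[folded n_def] _ \<rho> low0 F far conflict_total[OF n0]]) auto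
  moreover have "\<theta> * (1 / 3 - 1 / 256)
      \<le> avg TT (\<lambda>T. avg KK (\<lambda>K. of_bool (good T K))) * (1 / 3 - 2 ^ q * (1 - 1 / 128 / 2) ^ R)"
  proof (intro mult_mono frac)
    \<comment> \<open>A block of 256 trials contributes a factor of at most 1/2, so \<open>R\<close>
      trials absorb \<open>2 ^ q\<close> and leave \<open>1 / 2 ^ 8\<close>.\<close>
    have "(1 - 1 / 128 / 2 :: real) ^ 256 \<le> exp (- 1)"
      using exp_ge_one_minus_x_over_n_power_n[of 1 256] by simp
    also have "\<dots> \<le> 1 / 2" using exp_ge_add_one_self[of 1] by (simp add: exp_minus field_simps)
    finally have "((1 - 1 / 128 / 2 :: real) ^ 256) ^ (q + 8) \<le> (1 / 2) ^ (q + 8)"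
      by (intro power_mono) auto
    then have "2 ^ q * (1 - 1 / 128 / 2 :: real) ^ R \<le> 2 ^ q * (1 / 2) ^ (q + 8)"
      unfolding R power_mult by (intro mult_left_mono) auto
    also have "\<dots> = 1 / 256" by (simp add: power_add power_divide)
    finally show "1 / 3 - 1 / 256 \<le> 1 / 3 - 2 ^ q * (1 - 1 / 128 / 2 :: real) ^ R" by simp
    show "0 \<le> avg TT (\<lambda>T. avg KK (\<lambda>K. of_bool (good T K)))" by (intro avg_nonneg) auto
  qed auto
  moreover have "1 / 50000 \<le> \<theta> * (1 / 3 - 1 / 256)" by (simp add: \<theta>_def)
  moreover have "real (R\<^sup>2) * real ((n + 1) ^ (2 * D + 4)) / real (card upper)
      \<le> (real R)\<^sup>2 * (4 * real m + 1) ^ (2 * D + 4) / 4 ^ m"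
  proof (rule frac_le)
    show "4 ^ m \<le> real (card upper)" using upN N4 by linarith
  qed (simp_all add: n_def add.commute)
  moreover have "real M * (real ((R + q)\<^sup>2) * (real (L - D) / n) ^ n) \<le> (real R + real q)\<^sup>2 * exp (- (4 / 3 * real D))"
  proof -
    have "real M * (real (L - D) / n) ^ n \<le> exp (- (4 / 3 * real D))"
    proof (cases "D \<le> L")
      case True
      have "real (L - D) / n = 3 / 4 * (1 - 4 / 3 * real D / n)"
        using n0 True by (simp add: n_def L_def field_simps of_nat_diff)
      then have "(real (L - D) / n) ^ n = (3 / 4) ^ n * (1 - 4 / 3 * real D / n) ^ n"
        by (simp only: power_mult_distrib)
      also have "\<dots> \<le> (3 / 4) ^ n * exp (- (4 / 3 * real D))"
        using n0 True by (intro mult_left_mono exp_ge_one_minus_x_over_n_power_n) (auto simp: n_def L_def)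
      finally have "real M * (real (L - D) / n) ^ n \<le> (4 / 3) ^ n * ((3 / 4) ^ n * exp (- (4 / 3 * real D)))"
        using M_le by (intro mult_mono) auto
      then show ?thesis using inv by (simp flip: mult.assoc)
    next
      \<comment> \<open>Truncated subtraction makes \<open>L - D\<close> zero here, and the power
        vanishes since \<open>n > 0\<close>.\<close>
      case False
      then show ?thesis using n0 by (simp add: power_0_left)
    qed
    then have "(real R + real q)\<^sup>2 * (real M * (real (L - D) / n) ^ n) \<le> (real R + real q)\<^sup>2 * exp (- (4 / 3 * real D))"
      by (intro mult_left_mono) auto
    then show ?thesis by (simp add: mult_ac)
  qed
  moreover have "2 * real (R + q) * (2 * D + 4) / n = 2 * (real R + real q) * (2 * real D + 4) / (4 * real m)"
    by (simp add: n_def)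
  ultimately show ?thesis by linarith
qed

theorem theorem5p1:
  "\<exists>\<epsilon>\<^sub>0 c\<^sub>1 c\<^sub>2 :: real. \<epsilon>\<^sub>0 > 0 \<and> c\<^sub>1 > 0 \<and> c\<^sub>2 > 0 \<and>
     (\<exists>c :: real. \<exists>k n\<^sub>0 :: nat. c > 0 \<and>
       (\<forall>n \<ge> n\<^sub>0. 4 dvd n \<longrightarrow>
         (let N = real (n choose (3 * n div 4));
              F = {f. c\<^sub>1 * N \<le> real (card (ones n f)) \<and> real (card (ones n f)) \<le> c\<^sub>2 * N}
          in \<forall>q A. nonadaptive_tester n F \<epsilon>\<^sub>0 q A \<longrightarrow>
               real q \<ge> c * ln N / (ln (ln N)) ^ k)))"
proof -
  \<comment> \<open>With \<open>x = n / 4\<close>, \<open>Q x\<close> bounds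
    \<open>ln N / (ln (ln N))\<^sup>2\<close> through \<open>x \<le> ln N\<close> and
    \<open>ln N \<le> 4 * x\<close>. The squared logarithm sends the third error, of order
    \<open>Q x * d x / x\<close>, to 0.\<close>
  define Q where "Q x = 4 * x / (ln x)\<^sup>2" for x :: real
  \<comment> \<open>An upper bound for \<open>D\<close>, chosen below as \<open>3 * ln n\<close>
    rounded up: then \<open>exp (- (4 / 3 * D))\<close> is at most \<open>1 / n ^ 4\<close>, which
    outweighs \<open>(R + q)\<^sup>2\<close>.\<close>
  define d where "d x = 3 * ln (4 * x) + 1" for x :: real
  \<comment> \<open>Three errors below 1/200000 each sum to less than the 1/50000 that
    \<open>query_inequality\<close> demands.\<close>
  have "eventually (\<lambda>x::real. (256 * (Q x + 8))\<^sup>2 * exp (ln (4 * x + 1) * (2 * d x + 4)) / exp (x * ln 4) < 1 / 200000) at_top"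
    unfolding Q_def d_def by real_asymp
  moreover have "eventually (\<lambda>x::real. (257 * (Q x + 8))\<^sup>2 * exp (- (4 * ln (4 * x))) < 1 / 200000) at_top"
    unfolding Q_def by real_asymp
  moreover have "eventually (\<lambda>x::real. 2 * (257 * (Q x + 8)) * (2 * d x + 4) / (4 * x) < 1 / 200000) at_top"
    unfolding Q_def d_def by real_asymp
  moreover have "eventually (\<lambda>x::real. 11 \<le> x) at_top" by real_asymp
  ultimately have "eventually (\<lambda>x::real. 11 \<le> x \<and>
      (256 * (Q x + 8))\<^sup>2 * exp (ln (4 * x + 1) * (2 * d x + 4)) / exp (x * ln 4) < 1 / 200000 \<and>
      (257 * (Q x + 8))\<^sup>2 * exp (- (4 * ln (4 * x))) < 1 / 200000 \<and>
      2 * (257 * (Q x + 8)) * (2 * d x + 4) / (4 * x) < 1 / 200000) at_top"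
    by eventually_elim auto
  then obtain x\<^sub>0 :: real where x\<^sub>0: "\<And>x. x\<^sub>0 \<le> x \<Longrightarrow> 11 \<le> x \<and>
      (256 * (Q x + 8))\<^sup>2 * exp (ln (4 * x + 1) * (2 * d x + 4)) / exp (x * ln 4) < 1 / 200000 \<and>
      (257 * (Q x + 8))\<^sup>2 * exp (- (4 * ln (4 * x))) < 1 / 200000 \<and>
      2 * (257 * (Q x + 8)) * (2 * d x + 4) / (4 * x) < 1 / 200000"
    unfolding eventually_at_top_linorder by blast
  have main: "1 * ln N / (ln (ln N)) ^ 2 \<le> real q"
    if n: "n \<ge> 4 * nat \<lceil>x\<^sub>0\<rceil>" "4 dvd n" and N: "N = real (n choose (3 * n div 4))"
      and A: "nonadaptive_tester n {f. 1 / 64 * N \<le> real (card (ones n f)) \<and> real (card (ones n f)) \<le> 2 * N} (1 / 32768) q A"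
    for n N q A
  proof (rule ccontr)
    assume "\<not> 1 * ln N / (ln (ln N)) ^ 2 \<le> real q"
    then have q: "real q < ln N / (ln (ln N))\<^sup>2" by simp
    obtain m where m: "n = 4 * m" using n(2) by auto
    define x where "x = real m"
    have "x\<^sub>0 \<le> x" using n(1) m unfolding x_def by linarith
    note x = x\<^sub>0[OF this]
    have N': "N = real (4 * m choose (3 * m))" by (simp add: N m)
    have "4 ^ m \<le> N" using of_nat_mono[OF power4_le_choose[of m], where 'a = real] by (simp add: N')
    then have "ln (4 ^ m) \<le> ln N" by (intro ln_mono) auto
    moreover have "1 \<le> ln (4::real)"
      using exp_le by (subst ln_ge_iff) auto
    then have "x * 1 \<le> x * ln 4" using x by (intro mult_left_mono) auto
    ultimately have lnN: "x \<le> ln N" by (simp add: ln_realpow x_def)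
    have "N \<le> 2 ^ (4 * m)" unfolding N' using of_nat_mono[OF binomial_le_pow2[of "4 * m" "3 * m"], where 'a = real] by simp
    then have "ln N \<le> ln (2 ^ (4 * m))" using \<open>4 ^ m \<le> N\<close> by (intro ln_mono) (auto intro: less_le_trans[of 0 "4 ^ m"])
    also have "\<dots> = 4 * x * ln 2" by (simp add: ln_realpow x_def)
    also have "\<dots> \<le> 4 * x * 1" using x ln_2_less_1 by (intro mult_left_mono) auto
    finally have lnN': "ln N \<le> 4 * x" by simp
    have lnx: "0 < ln x" using x by (intro ln_gt_zero) auto
    have "ln x \<le> ln (ln N)" using x lnN by (intro ln_mono) auto
    then have "ln N / (ln (ln N))\<^sup>2 \<le> Q x"
      unfolding Q_def using lnN' lnx x by (intro frac_le power_mono) auto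
    with q have qQ: "real q \<le> Q x" by simp
    define D where "D = nat \<lceil>3 * ln (4 * x)\<rceil>"
    have ln0: "0 \<le> ln (4 * x)" using x by (intro ln_ge_zero) auto
    have D: "3 * ln (4 * x) \<le> real D" "real D \<le> d x"
      unfolding D_def d_def using ln0 by linarith+
    define R where "R = 256 * (q + 8)"
    have m11: "11 \<le> m" using x by (simp add: x_def)
    have R: "real R \<le> 256 * (Q x + 8)" "real R + real q \<le> 257 * (Q x + 8)"
      unfolding R_def using qQ by auto
    have "(real R)\<^sup>2 * (4 * x + 1) ^ (2 * D + 4) / 4 ^ m
        \<le> (256 * (Q x + 8))\<^sup>2 * exp (ln (4 * x + 1) * (2 * d x + 4)) / exp (x * ln 4)"
    proof (intro frac_le mult_mono power_mono)
      have "(4 * x + 1) ^ (2 * D + 4) = exp (ln (4 * x + 1)) ^ (2 * D + 4)" using x by simp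
      also have "\<dots> = exp (real (2 * D + 4) * ln (4 * x + 1))" by (rule exp_of_nat_mult[symmetric])
      also have "\<dots> \<le> exp (ln (4 * x + 1) * (2 * d x + 4))"
        using D x by (subst exp_le_cancel_iff, subst mult.commute, intro mult_left_mono) auto
      finally show "(4 * x + 1) ^ (2 * D + 4) \<le> exp (ln (4 * x + 1) * (2 * d x + 4))" .
      show "exp (x * ln 4) \<le> 4 ^ m" by (simp add: x_def exp_of_nat_mult)
    qed (use R x in auto)
    moreover have "(real R + real q)\<^sup>2 * exp (- (4 / 3 * real D)) \<le> (257 * (Q x + 8))\<^sup>2 * exp (- (4 * ln (4 * x)))"
      using R D by (intro mult_mono power_mono) auto
    moreover have "2 * (real R + real q) * (2 * real D + 4) / (4 * x) \<le> 2 * (257 * (Q x + 8)) * (2 * d x + 4) / (4 * x)"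
      using R D x by (intro divide_right_mono mult_mono) auto
    moreover have "1 / 50000 \<le> (real R)\<^sup>2 * (4 * x + 1) ^ (2 * D + 4) / 4 ^ m
      + (real R + real q)\<^sup>2 * exp (- (4 / 3 * real D)) + 2 * (real R + real q) * (2 * real D + 4) / (4 * x)"
      unfolding x_def by (rule query_inequality[OF m11 R_def]) (use A in \<open>simp add: m N'\<close>)
    ultimately show False using x by linarith
  qed
  show ?thesis
  proof (rule exI[of _ "1 / 32768"], rule exI[of _ "1 / 64"], rule exI[of _ 2], intro conjI)
    show "\<exists>c :: real. \<exists>k n\<^sub>0 :: nat. c > 0 \<and>
       (\<forall>n \<ge> n\<^sub>0. 4 dvd n \<longrightarrow>
         (let N = real (n choose (3 * n div 4));
              F = {f. 1 / 64 * N \<le> real (card (ones n f)) \<and> real (card (ones n f)) \<le> 2 * N}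
          in \<forall>q A. nonadaptive_tester n F (1 / 32768) q A \<longrightarrow>
               real q \<ge> c * ln N / (ln (ln N)) ^ k))"
      unfolding Let_def
      by (rule exI[of _ 1], rule exI[of _ 2], rule exI[of _ "4 * nat \<lceil>x\<^sub>0\<rceil>"],
          intro conjI zero_less_one allI impI, rule main[OF _ _ refl])
  qed auto
qed

end
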